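(* Let $(G_n)_{n\in\mathbb N}$ be an injective directed system of groups equipped with a cloning system, and let $G=\varinjlim G_n$. Then the set of simple elements of $\widehat{\mathscr T}(G)$ is a subgroup of $\widehat{\mathscr T}(G)$. This subgroup, denoted $\mathscr T(G_* )$ and called the generalized Thompson group of $G_*$, contains all of the $G_n$, i.e. for every $n\in\mathbb N$ it has a subgroup isomorphic to $G_n$.
   Context: Conventions: $\mathbb N=\{1,2,\dots\}$; $S_n$ is the symmetric group of $\{1,\dots,n\}$ acting on the left, $S_n\subseteq S_{n+1}$ and $S_\infty=\bigcup_n S_n$. Some maps are written on the right of their arguments and composed left to right. Cloning system. Let $(G_n)_{n\in\mathbb N}$ be groups with injective homomorphisms $\iota_{m,n}:G_m\to G_n$ ($m\le n$), $\iota_{m,m}=\mathrm{id}$, $((g)\iota_{m,n})\iota_{n,\ell}=(g)\iota_{m,\ell}$ (an injective directed system). A cloning system on it consists of homomorphisms $\rho_n:G_n\to S_n$ with $\rho_n((g)\iota_{m,n})=\rho_m(g)$ (viewed in $S_n$), and injective maps of sets (cloning maps) $\kappa^n_k:G_n\to G_{n+1}$, $1\le k\le n$, such that for $m,k\le n$ and $g\in G_m$: $((g)\iota_{m,n})\kappa^n_k=((g)\kappa^m_k)\iota_{m+1,n+1}$ if $k\le m$ and $=(g)\iota_{m,n+1}$ if $m<k$; and such that for all $g,h\in G_n$, $1\le k\le n$ and $k<\ell\le n$: (1) $(gh)\kappa^n_k=(g)\kappa^n_{\rho_n(h)k}\cdot(h)\kappa^n_k$; (2) $((g)\kappa^n_\ell)\kappa^{n+1}_k=((g)\kappa^n_k)\kappa^{n+1}_{\ell+1}$;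 (3) $\rho_{n+1}((g)\kappa^n_k)(i)=((\rho_n(g))\varsigma_k)(i)$ for all $i\ne k,k+1$, where for $\sigma\in S_\infty$ the permutation $(\sigma)\varsigma_k$ sends $m$ to: $\sigma m$ if $m\le k,\ \sigma m\le\sigma k$; $\sigma m+1$ if $m<k,\ \sigma m>\sigma k$; $\sigma(m-1)$ if $m>k,\ \sigma(m-1)<\sigma k$; $\sigma(m-1)+1$ if $m>k,\ \sigma(m-1)\ge\sigma k$. Put $\kappa^n_k=\iota_{n,n+1}$ for $k>n$. On $G=\varinjlim G_n$ (which contains all $G_n$) one gets induced $\rho:G\to S_\infty$ and $\kappa_k:G\to G$, $k\in\mathbb N$. Forests. $\mathscr F$ is the monoid generated by $\lambda_k$ ($k\in\mathbb N$) with defining relations $\lambda_j\lambda_i=\lambda_i\lambda_{j+1}$ for $i<j$. Its elements are forests: sequences $(T_i)_{i\in\mathbb N}$ of finite rooted full binary trees, almost all trivial (one leaf); $\lambda_k$ has $k$-th tree a single caret and all others trivial; $EE'$ is obtained by identifying the $i$-th leaf of $E$ with the $i$-th root of $E'$. A forest is semisimple with $n$ feet if $T_i$ is trivial for $i>1$ and $T_1$ has $n$ leaves. The group. $\mathscr F\bowtie G$ is the monoid generated by $\mathscr F$ and $G$ subject to $g\lambda_k=\lambda_{\rho(g)k}\,(g)\kappa_k$ ($g\in G$, $k\in\mathbb N$); every element is uniquely of the form $Eg$ with $E\in\mathscr F$, $g\in G$. It is cancellative with common right multiples, so it embeds in its group of right fractions $\widehat{\mathscr T}(G)$. Write $[E_-,g,E_+]=E_-gE_+^{-1}$.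 An element of $\widehat{\mathscr T}(G)$ is simple if it can be written $[E_-,g,E_+]$ with $E_-,E_+$ semisimple forests both with $n$ feet and $g\in G_n$, for some $n$. *)

theory Defs
  imports "HOL-Algebra.Sym_Groups"
begin

section \<open>Cloning systems\<close>

text \<open>The systems are indexed by the positive natural numbers; the values of the families at
  index 0 are irrelevant. Maps written on the right in the literature become ordinary function
  applications, e.g. \<open>\<kappa> n k g\<close> is \<open>(g)\<kappa>\<^sup>n\<^sub>k\<close>.\<close>

locale injective_directed_system =
  fixes G :: "nat \<Rightarrow> 'a monoid"
    and \<iota> :: "nat \<Rightarrow> nat \<Rightarrow> 'a \<Rightarrow> 'a"
  assumes group_G: "1 \<le> n \<Longrightarrow> group (G n)"
    and \<iota>_hom: "1 \<le> m \<Longrightarrow> m \<le> n \<Longrightarrow> \<iota> m n \<in> hom (G m) (G n)"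
    and \<iota>_inj: "1 \<le> m \<Longrightarrow> m \<le> n \<Longrightarrow> inj_on (\<iota> m n) (carrier (G m))"
    and \<iota>_id: "1 \<le> m \<Longrightarrow> g \<in> carrier (G m) \<Longrightarrow> \<iota> m m g = g"
    and \<iota>_comp: "1 \<le> m \<Longrightarrow> m \<le> n \<Longrightarrow> n \<le> l \<Longrightarrow> g \<in> carrier (G m)
                  \<Longrightarrow> \<iota> n l (\<iota> m n g) = \<iota> m l g"

definition perm_clone :: "nat \<Rightarrow> (nat \<Rightarrow> nat) \<Rightarrow> nat \<Rightarrow> nat" where
  "perm_clone k \<sigma> m =
     (if m \<le> k \<and> \<sigma> m \<le> \<sigma> k then \<sigma> m
      else if m < k \<and> \<sigma> m > \<sigma> k then \<sigma> m + 1
      else if m > k \<and> \<sigma> (m - 1) < \<sigma> k then \<sigma> (m - 1)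
      else \<sigma> (m - 1) + 1)"

text \<open>The library's \<open>sym_group n\<close> consists of permutations of all of \<open>nat\<close> fixing every point
  outside \<open>{1..n}\<close>, so the inclusions \<open>S\<^sub>m \<subseteq> S\<^sub>n\<close> are literal.\<close>

locale cloning_system = injective_directed_system G \<iota>
  for G :: "nat \<Rightarrow> 'a monoid" and \<iota> :: "nat \<Rightarrow> nat \<Rightarrow> 'a \<Rightarrow> 'a" +
  fixes \<rho> :: "nat \<Rightarrow> 'a \<Rightarrow> nat \<Rightarrow> nat"
    and \<kappa> :: "nat \<Rightarrow> nat \<Rightarrow> 'a \<Rightarrow> 'a"
  assumes \<rho>_hom: "1 \<le> n \<Longrightarrow> \<rho> n \<in> hom (G n) (sym_group n)"
    and \<rho>_\<iota>: "1 \<le> m \<Longrightarrow> m \<le> n \<Longrightarrow> g \<in> carrier (G m) \<Longrightarrow> \<rho> n (\<iota> m n g) = \<rho> m g"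
    and \<kappa>_closed: "1 \<le> k \<Longrightarrow> k \<le> n \<Longrightarrow> g \<in> carrier (G n) \<Longrightarrow> \<kappa> n k g \<in> carrier (G (n + 1))"
    and \<kappa>_inj: "1 \<le> k \<Longrightarrow> k \<le> n \<Longrightarrow> inj_on (\<kappa> n k) (carrier (G n))"
    and \<kappa>_\<iota>_le: "1 \<le> k \<Longrightarrow> k \<le> m \<Longrightarrow> m \<le> n \<Longrightarrow> g \<in> carrier (G m)
                  \<Longrightarrow> \<kappa> n k (\<iota> m n g) = \<iota> (m + 1) (n + 1) (\<kappa> m k g)"
    and \<kappa>_\<iota>_gt: "1 \<le> m \<Longrightarrow> m < k \<Longrightarrow> k \<le> n \<Longrightarrow> g \<in> carrier (G m)
                  \<Longrightarrow> \<kappa> n k (\<iota> m n g) = \<iota> m (n + 1) g"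
    and \<kappa>_mult: "1 \<le> k \<Longrightarrow> k \<le> n \<Longrightarrow> g \<in> carrier (G n) \<Longrightarrow> h \<in> carrier (G n)
                  \<Longrightarrow> \<kappa> n k (g \<otimes>\<^bsub>G n\<^esub> h) = \<kappa> n (\<rho> n h k) g \<otimes>\<^bsub>G (n + 1)\<^esub> \<kappa> n k h"
    and \<kappa>_\<kappa>: "1 \<le> k \<Longrightarrow> k < l \<Longrightarrow> l \<le> n \<Longrightarrow> g \<in> carrier (G n)
                  \<Longrightarrow> \<kappa> (n + 1) k (\<kappa> n l g) = \<kappa> (n + 1) (l + 1) (\<kappa> n k g)"
    and \<rho>_\<kappa>: "1 \<le> k \<Longrightarrow> k \<le> n \<Longrightarrow> g \<in> carrier (G n) \<Longrightarrow> 1 \<le> i \<Longrightarrow> i \<noteq> k \<Longrightarrow> i \<noteq> k + 1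
                  \<Longrightarrow> \<rho> (n + 1) (\<kappa> n k g) i = perm_clone k (\<rho> n g) i"


section \<open>The direct limit\<close>

text \<open>An element of the direct limit is an equivalence class of pairs \<open>(n, g)\<close> with
  \<open>g \<in> G\<^sub>n\<close>. Operations are defined on classes as unions over all representatives; for a
  cloning system these are unions of equal sets.\<close>

definition lim_rel :: "(nat \<Rightarrow> 'a monoid) \<Rightarrow> (nat \<Rightarrow> nat \<Rightarrow> 'a \<Rightarrow> 'a) \<Rightarrow> ((nat \<times> 'a) \<times> (nat \<times> 'a)) set" where
  "lim_rel G \<iota> = {((m, g), (n, h)) | m g n h.
     1 \<le> m \<and> 1 \<le> n \<and> g \<in> carrier (G m) \<and> h \<in> carrier (G n) \<and>
     (\<exists>l. m \<le> l \<and> n \<le> l \<and> \<iota> m l g = \<iota> n l h)}"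

definition lim_in :: "(nat \<Rightarrow> 'a monoid) \<Rightarrow> (nat \<Rightarrow> nat \<Rightarrow> 'a \<Rightarrow> 'a) \<Rightarrow> nat \<Rightarrow> 'a \<Rightarrow> (nat \<times> 'a) set" where
  "lim_in G \<iota> n g = lim_rel G \<iota> `` {(n, g)}"

definition lim_group :: "(nat \<Rightarrow> 'a monoid) \<Rightarrow> (nat \<Rightarrow> nat \<Rightarrow> 'a \<Rightarrow> 'a) \<Rightarrow> (nat \<times> 'a) set monoid" where
  "lim_group G \<iota> =
     \<lparr>carrier = (SIGMA n:{1..}. carrier (G n)) // lim_rel G \<iota>,
      mult = (\<lambda>X Y. \<Union>(m, g)\<in>X. \<Union>(n, h)\<in>Y.
                lim_in G \<iota> (max m n) (\<iota> m (max m n) g \<otimes>\<^bsub>G (max m n)\<^esub> \<iota> n (max m n) h)),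
      one = lim_in G \<iota> 1 \<one>\<^bsub>G 1\<^esub>\<rparr>"

definition lim_\<rho> :: "(nat \<Rightarrow> 'a \<Rightarrow> nat \<Rightarrow> nat) \<Rightarrow> (nat \<times> 'a) set \<Rightarrow> nat \<Rightarrow> nat" where
  "lim_\<rho> \<rho> X = (THE \<sigma>. \<exists>(n, g)\<in>X. \<sigma> = \<rho> n g)"

definition lim_\<kappa> :: "(nat \<Rightarrow> 'a monoid) \<Rightarrow> (nat \<Rightarrow> nat \<Rightarrow> 'a \<Rightarrow> 'a) \<Rightarrow> (nat \<Rightarrow> nat \<Rightarrow> 'a \<Rightarrow> 'a)
    \<Rightarrow> nat \<Rightarrow> (nat \<times> 'a) set \<Rightarrow> (nat \<times> 'a) set" where
  "lim_\<kappa> G \<iota> \<kappa> k X =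
     (\<Union>(n, g)\<in>X. lim_in G \<iota> (n + 1) (if k \<le> n then \<kappa> n k g else \<iota> n (n + 1) g))"


section \<open>The monoid of forests\<close>

datatype tree = Leaf | Caret tree tree

fun leaves :: "tree \<Rightarrow> nat" where
  "leaves Leaf = 1"
| "leaves (Caret s t) = leaves s + leaves t"

text \<open>\<open>graft t f\<close> replaces the \<open>i\<close>-th leaf of \<open>t\<close>, counted from 1 and left to right, by \<open>f i\<close>.\<close>

fun graft :: "tree \<Rightarrow> (nat \<Rightarrow> tree) \<Rightarrow> tree" where
  "graft Leaf f = f 1"
| "graft (Caret s t) f = Caret (graft s f) (graft t (\<lambda>i. f (i + leaves s)))"

text \<open>Trees of a forest are indexed by the positive naturals; the entry at 0 is a dummy.\<close>

type_synonym forest = "nat \<Rightarrow> tree"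

definition forest_mult :: "forest \<Rightarrow> forest \<Rightarrow> forest" where
  "forest_mult E E' = (\<lambda>i. if i = 0 then Leaf
     else graft (E i) (\<lambda>j. E' (j + (\<Sum>m = 1..<i. leaves (E m)))))"

definition forest_monoid :: "forest monoid" where
  "forest_monoid =
     \<lparr>carrier = {E. E 0 = Leaf \<and> finite {i. E i \<noteq> Leaf}}, mult = forest_mult, one = (\<lambda>_. Leaf)\<rparr>"

definition caret :: "nat \<Rightarrow> forest" where
  "caret k = (\<lambda>_. Leaf)(k := Caret Leaf Leaf)"

lemma caret_mult_caret:
  assumes "1 \<le> i" "i < j"
  shows "caret j \<otimes>\<^bsub>forest_monoid\<^esub> caret i = caret i \<otimes>\<^bsub>forest_monoid\<^esub> caret (j + 1)"
proof
  fix n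
  have 1: "(\<Sum>m = 1..<n. leaves (caret k m)) = (if 1 \<le> k \<and> k < n then n else n - 1)" for k
  proof -
    have "(\<Sum>m = 1..<n. leaves (caret k m)) = (\<Sum>m = 1..<n. 1 + (if m = k then 1 else 0))"
      by (intro sum.cong) (auto simp: caret_def)
    also have "\<dots> = (if 1 \<le> k \<and> k < n then n else n - 1)"
      by (subst sum.distrib) (auto simp: sum.delta)
    finally show ?thesis .
  qed
  show "(caret j \<otimes>\<^bsub>forest_monoid\<^esub> caret i) n = (caret i \<otimes>\<^bsub>forest_monoid\<^esub> caret (j + 1)) n"
    unfolding forest_monoid_def forest_mult_def monoid.simps 1
    using assms by (auto simp: caret_def)
qed

definition semisimple :: "nat \<Rightarrow> forest \<Rightarrow> bool" where
  "semisimple n E \<longleftrightarrow> E \<in> carrier forest_monoid \<and> (\<forall>i>1. E i = Leaf) \<and> leaves (E 1) = n"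


section \<open>Presented monoids and groups of right fractions\<close>

inductive_set word_cong :: "'x set \<Rightarrow> ('x list \<times> 'x list) set \<Rightarrow> ('x list \<times> 'x list) set"
  for A R where
  rel: "(u, v) \<in> R \<Longrightarrow> u \<in> lists A \<Longrightarrow> v \<in> lists A \<Longrightarrow> p \<in> lists A \<Longrightarrow> q \<in> lists A
          \<Longrightarrow> (p @ u @ q, p @ v @ q) \<in> word_cong A R"
| refl: "w \<in> lists A \<Longrightarrow> (w, w) \<in> word_cong A R"
| sym: "(u, v) \<in> word_cong A R \<Longrightarrow> (v, u) \<in> word_cong A R"
| trans: "(u, v) \<in> word_cong A R \<Longrightarrow> (v, w) \<in> word_cong A R \<Longrightarrow> (u, w) \<in> word_cong A R"

definition presented_monoid :: "'x set \<Rightarrow> ('x list \<times> 'x list) set \<Rightarrow> 'x list set monoid" where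
  "presented_monoid A R =
     \<lparr>carrier = lists A // word_cong A R,
      mult = (\<lambda>X Y. \<Union>u\<in>X. \<Union>v\<in>Y. word_cong A R `` {u @ v}),
      one = word_cong A R `` {[]}\<rparr>"

text \<open>The pair \<open>(a, b)\<close> represents the right fraction \<open>a b\<^sup>-\<^sup>1\<close>. To multiply \<open>a b\<^sup>-\<^sup>1\<close> by \<open>c d\<^sup>-\<^sup>1\<close>, choose
  a common right multiple \<open>b x = c y\<close>; the product is \<open>(a x) (d y)\<^sup>-\<^sup>1\<close>.\<close>

definition frac_rel :: "('m, 'b) monoid_scheme \<Rightarrow> (('m \<times> 'm) \<times> ('m \<times> 'm)) set" where
  "frac_rel M = {((a, b), (c, d)) | a b c d.
     a \<in> carrier M \<and> b \<in> carrier M \<and> c \<in> carrier M \<and> d \<in> carrier M \<and>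
     (\<exists>x\<in>carrier M. \<exists>y\<in>carrier M. a \<otimes>\<^bsub>M\<^esub> x = c \<otimes>\<^bsub>M\<^esub> y \<and> b \<otimes>\<^bsub>M\<^esub> x = d \<otimes>\<^bsub>M\<^esub> y)}"

definition frac_group :: "('m, 'b) monoid_scheme \<Rightarrow> ('m \<times> 'm) set monoid" where
  "frac_group M =
     \<lparr>carrier = (carrier M \<times> carrier M) // frac_rel M,
      mult = (\<lambda>X Y. \<Union>{frac_rel M `` {(a \<otimes>\<^bsub>M\<^esub> x, d \<otimes>\<^bsub>M\<^esub> y)} | a b c d x y.
                (a, b) \<in> X \<and> (c, d) \<in> Y \<and> x \<in> carrier M \<and> y \<in> carrier M \<and> b \<otimes>\<^bsub>M\<^esub> x = c \<otimes>\<^bsub>M\<^esub> y}),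
      one = frac_rel M `` {(\<one>\<^bsub>M\<^esub>, \<one>\<^bsub>M\<^esub>)}\<rparr>"

definition frac_in :: "('m, 'b) monoid_scheme \<Rightarrow> 'm \<Rightarrow> ('m \<times> 'm) set" where
  "frac_in M a = frac_rel M `` {(a, \<one>\<^bsub>M\<^esub>)}"


section \<open>Thompson groups of cloning systems\<close>

type_synonym 'a letter = "forest + (nat \<times> 'a) set"

definition fg_letters :: "(nat \<Rightarrow> 'a monoid) \<Rightarrow> (nat \<Rightarrow> nat \<Rightarrow> 'a \<Rightarrow> 'a) \<Rightarrow> 'a letter set" where
  "fg_letters G \<iota> = carrier forest_monoid <+> carrier (lim_group G \<iota>)"

text \<open>The first four kinds of relations say that the monoid operations of the forest monoid and of
  the direct limit are respected, the last one is \<open>g \<lambda>\<^sub>k = \<lambda>\<^bsub>\<rho>(g)k\<^esub> (g)\<kappa>\<^sub>k\<close>.\<close>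

definition fg_relations :: "(nat \<Rightarrow> 'a monoid) \<Rightarrow> (nat \<Rightarrow> nat \<Rightarrow> 'a \<Rightarrow> 'a) \<Rightarrow> (nat \<Rightarrow> 'a \<Rightarrow> nat \<Rightarrow> nat)
    \<Rightarrow> (nat \<Rightarrow> nat \<Rightarrow> 'a \<Rightarrow> 'a) \<Rightarrow> ('a letter list \<times> 'a letter list) set" where
  "fg_relations G \<iota> \<rho> \<kappa> =
     {([Inl \<one>\<^bsub>forest_monoid\<^esub>], [])} \<union>
     {([Inl E, Inl E'], [Inl (E \<otimes>\<^bsub>forest_monoid\<^esub> E')]) | E E'.
        E \<in> carrier forest_monoid \<and> E' \<in> carrier forest_monoid} \<union>
     {([Inr \<one>\<^bsub>lim_group G \<iota>\<^esub>], [])} \<union>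
     {([Inr g, Inr h], [Inr (g \<otimes>\<^bsub>lim_group G \<iota>\<^esub> h)]) | g h.
        g \<in> carrier (lim_group G \<iota>) \<and> h \<in> carrier (lim_group G \<iota>)} \<union>
     {([Inr g, Inl (caret k)], [Inl (caret (lim_\<rho> \<rho> g k)), Inr (lim_\<kappa> G \<iota> \<kappa> k g)]) | g k.
        g \<in> carrier (lim_group G \<iota>) \<and> 1 \<le> k}"

definition fg_monoid :: "(nat \<Rightarrow> 'a monoid) \<Rightarrow> (nat \<Rightarrow> nat \<Rightarrow> 'a \<Rightarrow> 'a) \<Rightarrow> (nat \<Rightarrow> 'a \<Rightarrow> nat \<Rightarrow> nat)
    \<Rightarrow> (nat \<Rightarrow> nat \<Rightarrow> 'a \<Rightarrow> 'a) \<Rightarrow> 'a letter list set monoid" where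
  "fg_monoid G \<iota> \<rho> \<kappa> = presented_monoid (fg_letters G \<iota>) (fg_relations G \<iota> \<rho> \<kappa>)"

type_synonym 'a thompson_elt = "('a letter list set \<times> 'a letter list set) set"

definition big_thompson_group :: "(nat \<Rightarrow> 'a monoid) \<Rightarrow> (nat \<Rightarrow> nat \<Rightarrow> 'a \<Rightarrow> 'a)
    \<Rightarrow> (nat \<Rightarrow> 'a \<Rightarrow> nat \<Rightarrow> nat) \<Rightarrow> (nat \<Rightarrow> nat \<Rightarrow> 'a \<Rightarrow> 'a) \<Rightarrow> 'a thompson_elt monoid" where
  "big_thompson_group G \<iota> \<rho> \<kappa> = frac_group (fg_monoid G \<iota> \<rho> \<kappa>)"

text \<open>The image of a single letter (a forest or an element of the direct limit).\<close>

definition thompson_in :: "(nat \<Rightarrow> 'a monoid) \<Rightarrow> (nat \<Rightarrow> nat \<Rightarrow> 'a \<Rightarrow> 'a) \<Rightarrow> (nat \<Rightarrow> 'a \<Rightarrow> nat \<Rightarrow> nat)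
    \<Rightarrow> (nat \<Rightarrow> nat \<Rightarrow> 'a \<Rightarrow> 'a) \<Rightarrow> 'a letter \<Rightarrow> 'a thompson_elt" where
  "thompson_in G \<iota> \<rho> \<kappa> x =
     frac_in (fg_monoid G \<iota> \<rho> \<kappa>) (word_cong (fg_letters G \<iota>) (fg_relations G \<iota> \<rho> \<kappa>) `` {[x]})"

definition thompson_bracket :: "(nat \<Rightarrow> 'a monoid) \<Rightarrow> (nat \<Rightarrow> nat \<Rightarrow> 'a \<Rightarrow> 'a)
    \<Rightarrow> (nat \<Rightarrow> 'a \<Rightarrow> nat \<Rightarrow> nat) \<Rightarrow> (nat \<Rightarrow> nat \<Rightarrow> 'a \<Rightarrow> 'a)
    \<Rightarrow> forest \<Rightarrow> (nat \<times> 'a) set \<Rightarrow> forest \<Rightarrow> 'a thompson_elt" where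
  "thompson_bracket G \<iota> \<rho> \<kappa> E g E' =
     thompson_in G \<iota> \<rho> \<kappa> (Inl E) \<otimes>\<^bsub>big_thompson_group G \<iota> \<rho> \<kappa>\<^esub> thompson_in G \<iota> \<rho> \<kappa> (Inr g)
       \<otimes>\<^bsub>big_thompson_group G \<iota> \<rho> \<kappa>\<^esub> inv\<^bsub>big_thompson_group G \<iota> \<rho> \<kappa>\<^esub> thompson_in G \<iota> \<rho> \<kappa> (Inl E')"

definition simple_elements :: "(nat \<Rightarrow> 'a monoid) \<Rightarrow> (nat \<Rightarrow> nat \<Rightarrow> 'a \<Rightarrow> 'a)
    \<Rightarrow> (nat \<Rightarrow> 'a \<Rightarrow> nat \<Rightarrow> nat) \<Rightarrow> (nat \<Rightarrow> nat \<Rightarrow> 'a \<Rightarrow> 'a) \<Rightarrow> 'a thompson_elt set" where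
  "simple_elements G \<iota> \<rho> \<kappa> =
     {thompson_bracket G \<iota> \<rho> \<kappa> E (lim_in G \<iota> n g) E' | E g E' n.
        1 \<le> n \<and> semisimple n E \<and> semisimple n E' \<and> g \<in> carrier (G n)}"

definition generalized_thompson_group :: "(nat \<Rightarrow> 'a monoid) \<Rightarrow> (nat \<Rightarrow> nat \<Rightarrow> 'a \<Rightarrow> 'a)
    \<Rightarrow> (nat \<Rightarrow> 'a \<Rightarrow> nat \<Rightarrow> nat) \<Rightarrow> (nat \<Rightarrow> nat \<Rightarrow> 'a \<Rightarrow> 'a) \<Rightarrow> 'a thompson_elt monoid" where
  "generalized_thompson_group G \<iota> \<rho> \<kappa> =
     (big_thompson_group G \<iota> \<rho> \<kappa>)\<lparr>carrier := simple_elements G \<iota> \<rho> \<kappa>\<rparr>"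

end

theory Submission
  imports Defs
begin

text \<open>Pushing a group element through a word in the carets by means of the defining relations
  defines an action of \<open>G\<close> on such words. The relations among the carets are respected because
  \<open>\<rho>((g)\<kappa>\<^sub>k)\<close> agrees with \<open>(\<rho>(g))\<varsigma>\<^sub>k\<close> off \<open>{k, k + 1}\<close>, and they are all relations
  among the carets, since \<open>\<lambda>\<^sub>k\<close> and \<open>\<lambda>\<^sub>l\<close> have the least common right multiple
  \<open>\<lambda>\<^sub>k \<lambda>\<^bsub>l+1\<^esub> = \<lambda>\<^sub>l \<lambda>\<^sub>k\<close> for \<open>k < l\<close>. So \<open>G\<close> acts on forests, and the monoid acts on
  pairs of a forest and a group element; evaluating this action at the trivial pair shows that the
  normal form \<open>E g\<close> is unique. Left cancellation and common right multiples, hence the group of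
  fractions, follow from those for forests.

  For simple elements \<open>x = E\<^sub>1 g E\<^sub>2\<^sup>-\<^sup>1\<close> and \<open>y = E\<^sub>3 h E\<^sub>4\<^sup>-\<^sup>1\<close> choose forests with
  \<open>E\<^sub>2 F = E\<^sub>3 F'\<close> semisimple and write \<open>g F = P a\<close>, \<open>h\<^sup>-\<^sup>1 F' = Q b\<close>; then
  \<open>x y = (E\<^sub>1 P) (a b\<^sup>-\<^sup>1) (E\<^sub>4 Q)\<^sup>-\<^sup>1\<close>. Finally \<open>g \<mapsto> E g E\<^sup>-\<^sup>1\<close> embeds \<open>G\<^sub>n\<close> when \<open>E\<close> has
  \<open>n\<close> feet; it is injective because the cloning maps are.\<close>

section \<open>Groups of right fractions\<close>

text \<open>These axioms produce a group of right fractions, but \<open>a\<close> and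
  \<open>b\<close> with \<open>a \<otimes> x = b \<otimes> x\<close> acquire the same image there
  (\<open>frac_in_eq_iff\<close>). Injectivity on group elements is therefore a separate matter,
  settled in \<open>of_group_frac_inject\<close>.\<close>

locale ore_monoid = monoid M for M (structure) +
  assumes l_cancel: "a \<in> carrier M \<Longrightarrow> b \<in> carrier M \<Longrightarrow> c \<in> carrier M \<Longrightarrow> a \<otimes> b = a \<otimes> c \<Longrightarrow> b = c"
    and common_multiple: "a \<in> carrier M \<Longrightarrow> b \<in> carrier M
      \<Longrightarrow> \<exists>x\<in>carrier M. \<exists>y\<in>carrier M. a \<otimes> x = b \<otimes> y"
begin

definition frac :: "'a \<Rightarrow> 'a \<Rightarrow> ('a \<times> 'a) set" where
  "frac a b = frac_rel M `` {(a, b)}"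

lemma frac_relI:
  assumes "a \<in> carrier M" "b \<in> carrier M" "c \<in> carrier M" "d \<in> carrier M"
    "x \<in> carrier M" "y \<in> carrier M" "a \<otimes> x = c \<otimes> y" "b \<otimes> x = d \<otimes> y"
  shows "((a, b), (c, d)) \<in> frac_rel M"
  using assms by (auto simp: frac_rel_def)

lemma equiv_frac_rel: "equiv (carrier M \<times> carrier M) (frac_rel M)"
proof (rule equivI)
  show "frac_rel M \<subseteq> (carrier M \<times> carrier M) \<times> (carrier M \<times> carrier M)"
    by (auto simp: frac_rel_def)
  show "refl_on (carrier M \<times> carrier M) (frac_rel M)"
    by (auto intro!: refl_onI frac_relI[where x = \<one> and y = \<one>])
  show "sym (frac_rel M)"
    by (rule symI) (auto simp: frac_rel_def, metis)
  show "trans (frac_rel M)"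
  proof (rule transI, clarify)
    fix a b c d e f
    assume 1: "((a, b), (c, d)) \<in> frac_rel M" and 2: "((c, d), (e, f)) \<in> frac_rel M"
    from 1 obtain x y where xy: "x \<in> carrier M" "y \<in> carrier M" "a \<otimes> x = c \<otimes> y" "b \<otimes> x = d \<otimes> y"
      by (auto simp: frac_rel_def)
    from 2 obtain x' y' where xy': "x' \<in> carrier M" "y' \<in> carrier M" "c \<otimes> x' = e \<otimes> y'" "d \<otimes> x' = f \<otimes> y'"
      by (auto simp: frac_rel_def)
    have C: "a \<in> carrier M" "b \<in> carrier M" "c \<in> carrier M" "d \<in> carrier M" "e \<in> carrier M" "f \<in> carrier M"
      using 1 2 by (auto simp: frac_rel_def)
    \<comment> \<open>A common multiple of the two multipliers of the middle fraction makes both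
      expansions comparable. The computation that follows serves the numerators and the denominators
      alike.\<close>
    obtain z z' where z: "z \<in> carrier M" "z' \<in> carrier M" "y \<otimes> z = x' \<otimes> z'"
      using common_multiple[of y x'] xy xy' by auto
    have "s \<otimes> (x \<otimes> z) = u \<otimes> (y' \<otimes> z')"
      if "s \<in> carrier M" "t \<in> carrier M" "u \<in> carrier M" "s \<otimes> x = t \<otimes> y" "t \<otimes> x' = u \<otimes> y'" for s t u
    proof -
      have "s \<otimes> (x \<otimes> z) = t \<otimes> (y \<otimes> z)"
        using that xy(1,2) z(1,2) by (simp flip: m_assoc)
      also have "\<dots> = t \<otimes> (x' \<otimes> z')"
        by (simp add: z)
      also have "\<dots> = u \<otimes> (y' \<otimes> z')"
        using that xy'(1,2) z(1,2) by (simp flip: m_assoc)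
      finally show ?thesis .
    qed
    then show "((a, b), (e, f)) \<in> frac_rel M"
      using xy xy' C z by (intro frac_relI[where x = "x \<otimes> z" and y = "y' \<otimes> z'"]) auto
  qed
qed

lemma frac_eq_iff:
  assumes "a \<in> carrier M" "b \<in> carrier M" "c \<in> carrier M" "d \<in> carrier M"
  shows "frac a b = frac c d \<longleftrightarrow>
    (\<exists>x\<in>carrier M. \<exists>y\<in>carrier M. a \<otimes> x = c \<otimes> y \<and> b \<otimes> x = d \<otimes> y)"
proof -
  have "frac a b = frac c d \<longleftrightarrow> ((a, b), (c, d)) \<in> frac_rel M"
    unfolding frac_def using assms by (intro eq_equiv_class_iff[OF equiv_frac_rel]) auto
  then show ?thesis
    using assms by (auto simp: frac_rel_def)
qed

lemma in_frac:
  "a \<in> carrier M \<Longrightarrow> b \<in> carrier M \<Longrightarrow>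
    (c, d) \<in> frac a b \<longleftrightarrow> c \<in> carrier M \<and> d \<in> carrier M \<and> frac a b = frac c d"
  using equiv_class_eq_iff[OF equiv_frac_rel, of "(a, b)" "(c, d)"] by (auto simp: frac_def)

lemma carrier_frac_group: "carrier (frac_group M) = {frac a b |a b. a \<in> carrier M \<and> b \<in> carrier M}"
  by (auto simp: frac_group_def frac_def quotient_def)

lemma frac_closed: "a \<in> carrier M \<Longrightarrow> b \<in> carrier M \<Longrightarrow> frac a b \<in> carrier (frac_group M)"
  by (auto simp: carrier_frac_group)

text \<open>Well-definedness in one statement: representatives and the chosen common multiples vary
  simultaneously. The multipliers are found by first matching the left factors, then enlarging once
  more to match the right factors.\<close>

lemma frac_mult_cong:
  assumes C: "a \<in> carrier M" "b \<in> carrier M" "c \<in> carrier M" "d \<in> carrier M"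
    "a' \<in> carrier M" "b' \<in> carrier M" "c' \<in> carrier M" "d' \<in> carrier M"
    "x \<in> carrier M" "y \<in> carrier M" "x' \<in> carrier M" "y' \<in> carrier M"
    and ab: "frac a b = frac a' b'" and cd: "frac c d = frac c' d'"
    and bx: "b \<otimes> x = c \<otimes> y" and bx': "b' \<otimes> x' = c' \<otimes> y'"
  shows "frac (a \<otimes> x) (d \<otimes> y) = frac (a' \<otimes> x') (d' \<otimes> y')"
proof -
  obtain p p' where p: "p \<in> carrier M" "p' \<in> carrier M" "a \<otimes> p = a' \<otimes> p'" "b \<otimes> p = b' \<otimes> p'"
    using ab C frac_eq_iff by auto
  obtain q q' where q: "q \<in> carrier M" "q' \<in> carrier M" "c \<otimes> q = c' \<otimes> q'" "d \<otimes> q = d' \<otimes> q'"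
    using cd C frac_eq_iff by auto
  \<comment> \<open>The multipliers \<open>u1 \<otimes> z\<close> and \<open>w\<close> turn
    \<open>x\<close> and \<open>x'\<close> into multiples of \<open>p\<close> and \<open>p'\<close>
    by the same element \<open>v1 \<otimes> z\<close>. Hence every relation
    \<open>s \<otimes> p = s' \<otimes> p'\<close> carries over; it is used for \<open>a, a'\<close>
    and for \<open>b, b'\<close>.\<close>
  obtain u1 v1 where u1: "u1 \<in> carrier M" "v1 \<in> carrier M" "x \<otimes> u1 = p \<otimes> v1"
    using common_multiple[of x p] C p by auto
  obtain w z where w: "w \<in> carrier M" "z \<in> carrier M" "x' \<otimes> w = (p' \<otimes> v1) \<otimes> z"
    using common_multiple[of x' "p' \<otimes> v1"] C p u1 by auto
  have *: "s \<otimes> x \<otimes> (u1 \<otimes> z) = s' \<otimes> x' \<otimes> w"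
    if "s \<in> carrier M" "s' \<in> carrier M" "s \<otimes> p = s' \<otimes> p'" for s s'
  proof -
    have "s \<otimes> x \<otimes> (u1 \<otimes> z) = s \<otimes> (x \<otimes> u1) \<otimes> z"
      using that C u1(1) w(1,2) by (simp add: m_assoc)
    also have "\<dots> = (s \<otimes> p) \<otimes> v1 \<otimes> z"
      using that(1,2) p(1) u1 w(1,2) by (simp add: m_assoc)
    also have "\<dots> = s' \<otimes> ((p' \<otimes> v1) \<otimes> z)"
      unfolding that(3) using that(1,2) p u1 w(1,2) by (simp add: m_assoc)
    also have "\<dots> = s' \<otimes> (x' \<otimes> w)"
      by (simp add: w)
    finally show ?thesis
      using that C w by (simp add: m_assoc)
  qed
  define u where "u = u1 \<otimes> z"
  have u: "u \<in> carrier M"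
    using u1 w by (simp add: u_def)
  have A: "a \<otimes> x \<otimes> u = a' \<otimes> x' \<otimes> w"
    using * C p by (simp add: u_def)
  have B: "c \<otimes> y \<otimes> u = c' \<otimes> y' \<otimes> w"
    using *[of b b'] C p bx bx' by (simp add: u_def)
  \<comment> \<open>One more expansion makes \<open>y \<otimes> u\<close> a multiple of
    \<open>q\<close>, so that the relations between \<open>c, d\<close> and \<open>c', d'\<close>
    apply. Left cancellation of \<open>c'\<close> then identifies the corresponding multiple of
    \<open>q'\<close>.\<close>
  obtain s t where s: "s \<in> carrier M" "t \<in> carrier M" "y \<otimes> u \<otimes> s = q \<otimes> t"
    using common_multiple[of "y \<otimes> u" q] C q u by auto
  have "c' \<otimes> (q' \<otimes> t) = c \<otimes> (q \<otimes> t)"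
    using q s C by (simp flip: m_assoc)
  also have "\<dots> = c \<otimes> y \<otimes> u \<otimes> s"
    unfolding s(3)[symmetric] using s(1,2) C u by (simp add: m_assoc)
  also have "\<dots> = c' \<otimes> (y' \<otimes> w \<otimes> s)"
    unfolding B using s(1) C w(1) by (simp add: m_assoc)
  finally have "c' \<otimes> (q' \<otimes> t) = c' \<otimes> (y' \<otimes> w \<otimes> s)" .
  moreover have "q' \<otimes> t \<in> carrier M" "y' \<otimes> w \<otimes> s \<in> carrier M"
    using C q(2) s(1,2) w(1) by simp_all
  ultimately have D: "q' \<otimes> t = y' \<otimes> w \<otimes> s"
    by (rule l_cancel[OF C(7), rotated 2])
  have "d \<otimes> y \<otimes> (u \<otimes> s) = d \<otimes> (q \<otimes> t)"
    unfolding s(3)[symmetric] using s(1,2) C u by (simp add: m_assoc)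
  also have "\<dots> = d' \<otimes> (q' \<otimes> t)"
    using q s(1,2) C by (simp flip: m_assoc)
  also have "\<dots> = d' \<otimes> y' \<otimes> (w \<otimes> s)"
    unfolding D using s(1) C w(1) by (simp add: m_assoc)
  finally have "d \<otimes> y \<otimes> (u \<otimes> s) = d' \<otimes> y' \<otimes> (w \<otimes> s)" .
  moreover have "a \<otimes> x \<otimes> (u \<otimes> s) = a' \<otimes> x' \<otimes> (w \<otimes> s)"
    using A C s(1) u w(1) by (simp flip: m_assoc)
  moreover have "u \<otimes> s \<in> carrier M" "w \<otimes> s \<in> carrier M"
    using u s(1) w(1) by auto
  ultimately show ?thesis
    using C by (subst frac_eq_iff) auto
qed

text \<open>By \<open>frac_mult_cong\<close> all classes in the union that defines the product
  coincide, so one common multiple suffices to compute it.\<close>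

lemma frac_mult:
  assumes C: "a \<in> carrier M" "b \<in> carrier M" "c \<in> carrier M" "d \<in> carrier M"
    "x \<in> carrier M" "y \<in> carrier M" and bx: "b \<otimes> x = c \<otimes> y"
  shows "frac a b \<otimes>\<^bsub>frac_group M\<^esub> frac c d = frac (a \<otimes> x) (d \<otimes> y)"
proof -
  have "{frac_rel M `` {(a' \<otimes> x', d' \<otimes> y')} | a' b' c' d' x' y'.
          (a', b') \<in> frac a b \<and> (c', d') \<in> frac c d \<and> x' \<in> carrier M \<and> y' \<in> carrier M
          \<and> b' \<otimes> x' = c' \<otimes> y'} = {frac (a \<otimes> x) (d \<otimes> y)}" (is "?S = _")
  proof (intro equalityI subsetI)
    fix X assume "X \<in> ?S"
    then obtain a' b' c' d' x' y' where X: "X = frac (a' \<otimes> x') (d' \<otimes> y')"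
      and *: "(a', b') \<in> frac a b" "(c', d') \<in> frac c d" "x' \<in> carrier M" "y' \<in> carrier M"
        "b' \<otimes> x' = c' \<otimes> y'"
      by (auto simp: frac_def)
    have "frac (a \<otimes> x) (d \<otimes> y) = frac (a' \<otimes> x') (d' \<otimes> y')"
      by (rule frac_mult_cong[of a b c d a' b' c' d' x y x' y']) (use C bx * in_frac in auto)
    then show "X \<in> {frac (a \<otimes> x) (d \<otimes> y)}"
      by (simp add: X)
  next
    fix X assume "X \<in> {frac (a \<otimes> x) (d \<otimes> y)}"
    moreover have "(a, b) \<in> frac a b" "(c, d) \<in> frac c d"
      using C in_frac by auto
    ultimately show "X \<in> ?S"
      using C bx unfolding frac_def by blast
  qed
  then show ?thesis
    by (simp add: frac_group_def)
qed

lemma group_frac_group: "group (frac_group M)"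
proof (rule groupI)
  fix X Y assume "X \<in> carrier (frac_group M)" "Y \<in> carrier (frac_group M)"
  then obtain a b c d where *: "X = frac a b" "Y = frac c d"
    "a \<in> carrier M" "b \<in> carrier M" "c \<in> carrier M" "d \<in> carrier M"
    by (auto simp: carrier_frac_group)
  obtain x y where "x \<in> carrier M" "y \<in> carrier M" "b \<otimes> x = c \<otimes> y"
    using common_multiple[of b c] * by auto
  then show "X \<otimes>\<^bsub>frac_group M\<^esub> Y \<in> carrier (frac_group M)"
    using * by (simp add: frac_mult frac_closed)
next
  have one: "\<one>\<^bsub>frac_group M\<^esub> = frac \<one> \<one>"
    by (simp add: frac_group_def frac_def)
  then show "\<one>\<^bsub>frac_group M\<^esub> \<in> carrier (frac_group M)"
    by (simp add: frac_closed)
  fix X assume "X \<in> carrier (frac_group M)"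
  then obtain a b where *: "X = frac a b" "a \<in> carrier M" "b \<in> carrier M"
    by (auto simp: carrier_frac_group)
  then show "\<one>\<^bsub>frac_group M\<^esub> \<otimes>\<^bsub>frac_group M\<^esub> X = X"
    using frac_mult[of \<one> \<one> a b a \<one>] by (simp add: one)
  have "frac b a \<otimes>\<^bsub>frac_group M\<^esub> X = frac b b"
    using * frac_mult[of b a a b \<one> \<one>] by simp
  also have "\<dots> = frac \<one> \<one>"
    using * by (subst frac_eq_iff) (auto intro!: bexI[of _ \<one>] bexI[of _ b])
  finally show "\<exists>Y\<in>carrier (frac_group M). Y \<otimes>\<^bsub>frac_group M\<^esub> X = \<one>\<^bsub>frac_group M\<^esub>"
    using * one frac_closed by auto
next
  fix X Y Z
  assume "X \<in> carrier (frac_group M)" "Y \<in> carrier (frac_group M)" "Z \<in> carrier (frac_group M)"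
  then obtain a b c d e f where *: "X = frac a b" "Y = frac c d" "Z = frac e f"
    and C: "a \<in> carrier M" "b \<in> carrier M" "c \<in> carrier M" "d \<in> carrier M" "e \<in> carrier M" "f \<in> carrier M"
    by (auto simp: carrier_frac_group)
  obtain x y where xy: "x \<in> carrier M" "y \<in> carrier M" "b \<otimes> x = c \<otimes> y"
    using common_multiple[of b c] C by auto
  \<comment> \<open>The second common multiple starts from the denominator
    \<open>d \<otimes> y\<close> of the product of the first two fractions; the same
    \<open>u\<close> and \<open>v\<close> then compute the other bracketing.\<close>
  obtain u v where uv: "u \<in> carrier M" "v \<in> carrier M" "(d \<otimes> y) \<otimes> u = e \<otimes> v"
    using common_multiple[of "d \<otimes> y" e] C xy by auto
  have "X \<otimes>\<^bsub>frac_group M\<^esub> Y \<otimes>\<^bsub>frac_group M\<^esub> Z = frac (a \<otimes> x \<otimes> u) (f \<otimes> v)"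
    using * C xy uv frac_mult[of a b c d x y] frac_mult[of "a \<otimes> x" "d \<otimes> y" e f u v] by simp
  moreover have "Y \<otimes>\<^bsub>frac_group M\<^esub> Z = frac (c \<otimes> (y \<otimes> u)) (f \<otimes> v)"
    using * C xy uv frac_mult[of c d e f "y \<otimes> u" v] by (simp add: m_assoc)
  moreover have "X \<otimes>\<^bsub>frac_group M\<^esub> frac (c \<otimes> (y \<otimes> u)) (f \<otimes> v) = frac (a \<otimes> (x \<otimes> u)) (f \<otimes> v)"
  proof -
    have "b \<otimes> (x \<otimes> u) = c \<otimes> (y \<otimes> u) \<otimes> \<one>"
      using C xy uv by (simp flip: m_assoc)
    then show ?thesis
      using * C xy uv frac_mult[of a b "c \<otimes> (y \<otimes> u)" "f \<otimes> v" "x \<otimes> u" \<one>] by simp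
  qed
  ultimately show "X \<otimes>\<^bsub>frac_group M\<^esub> Y \<otimes>\<^bsub>frac_group M\<^esub> Z = X \<otimes>\<^bsub>frac_group M\<^esub> (Y \<otimes>\<^bsub>frac_group M\<^esub> Z)"
    using C xy uv by (simp add: m_assoc)
qed

lemma frac_in_eq: "frac_in M a = frac a \<one>"
  by (simp add: frac_in_def frac_def)

lemma frac_in_hom: "frac_in M \<in> hom M (frac_group M)"
proof (rule homI)
  fix a b assume "a \<in> carrier M" "b \<in> carrier M"
  then show "frac_in M (a \<otimes> b) = frac_in M a \<otimes>\<^bsub>frac_group M\<^esub> frac_in M b"
    using frac_mult[of a \<one> b \<one> b \<one>] by (simp add: frac_in_eq)
qed (simp add: frac_in_eq frac_closed)

lemma frac_in_eq_iff:
  assumes "a \<in> carrier M" "b \<in> carrier M"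
  shows "frac_in M a = frac_in M b \<longleftrightarrow> (\<exists>x\<in>carrier M. a \<otimes> x = b \<otimes> x)"
  using assms by (auto simp: frac_in_eq frac_eq_iff)

end


section \<open>Presented monoids\<close>

lemma word_cong_in_lists: "(u, v) \<in> word_cong A R \<Longrightarrow> u \<in> lists A \<and> v \<in> lists A"
  by (induction rule: word_cong.induct) auto

lemma equiv_word_cong: "equiv (lists A) (word_cong A R)"
  by (rule equivI) (auto intro!: refl_onI symI transI intro: word_cong.refl word_cong.sym word_cong.trans
      dest: word_cong_in_lists)

text \<open>The generating pairs already carry a context, so enlarging it by \<open>p\<close> and
  \<open>q\<close> gives generating pairs again. This makes concatenation of classes well
  defined.\<close>

lemma word_cong_context:
  assumes "(u, v) \<in> word_cong A R" and pq: "p \<in> lists A" "q \<in> lists A"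
  shows "(p @ u @ q, p @ v @ q) \<in> word_cong A R"
  using assms(1)
proof (induction rule: word_cong.induct)
  case (rel u v p' q')
  then show ?case
    using word_cong.rel[of u v R A "p @ p'" "q' @ q"] pq by simp
next
  case (refl w)
  then show ?case
    using pq by (intro word_cong.refl) simp
qed (auto intro: word_cong.sym word_cong.trans)

definition word_class :: "'x set \<Rightarrow> ('x list \<times> 'x list) set \<Rightarrow> 'x list \<Rightarrow> 'x list set" where
  "word_class A R w = word_cong A R `` {w}"

lemma word_class_eq_iff:
  "u \<in> lists A \<Longrightarrow> v \<in> lists A \<Longrightarrow> word_class A R u = word_class A R v \<longleftrightarrow> (u, v) \<in> word_cong A R"
  unfolding word_class_def by (intro eq_equiv_class_iff[OF equiv_word_cong])

lemma carrier_presented_monoid: "carrier (presented_monoid A R) = word_class A R ` lists A"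
  by (auto simp: presented_monoid_def word_class_def quotient_def)

lemma one_presented_monoid: "\<one>\<^bsub>presented_monoid A R\<^esub> = word_class A R []"
  by (simp add: presented_monoid_def word_class_def)

lemma mult_presented_monoid:
  assumes "u \<in> lists A" "v \<in> lists A"
  shows "word_class A R u \<otimes>\<^bsub>presented_monoid A R\<^esub> word_class A R v = word_class A R (u @ v)"
proof -
  have "word_class A R (u' @ v') = word_class A R (u @ v)"
    if "u' \<in> word_class A R u" "v' \<in> word_class A R v" for u' v'
  proof -
    have *: "(u, u') \<in> word_cong A R" "(v, v') \<in> word_cong A R"
      using that by (auto simp: word_class_def)
    then have L: "u' \<in> lists A" "v' \<in> lists A"
      by (auto dest: word_cong_in_lists)
    have "(u @ v, u' @ v) \<in> word_cong A R" "(u' @ v, u' @ v') \<in> word_cong A R"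
      using word_cong_context[OF *(1), of "[]" v] word_cong_context[OF *(2), of u' "[]"] assms L by auto
    then have "(u @ v, u' @ v') \<in> word_cong A R"
      by (rule word_cong.trans)
    then show ?thesis
      using assms L by (subst word_class_eq_iff) (auto intro: word_cong.sym)
  qed
  moreover have "u \<in> word_class A R u" "v \<in> word_class A R v"
    using assms by (auto simp: word_class_def intro: word_cong.refl)
  ultimately have "(\<Union>u'\<in>word_class A R u. \<Union>v'\<in>word_class A R v. word_class A R (u' @ v')) = word_class A R (u @ v)"
    by blast
  then show ?thesis
    by (simp add: presented_monoid_def word_class_def)
qed

lemma monoid_presented_monoid: "monoid (presented_monoid A R)"
proof (rule monoid.intro)
  fix X Y Z
  assume "X \<in> carrier (presented_monoid A R)" "Y \<in> carrier (presented_monoid A R)"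
    "Z \<in> carrier (presented_monoid A R)"
  then obtain u v w where "X = word_class A R u" "u \<in> lists A" "Y = word_class A R v" "v \<in> lists A"
    "Z = word_class A R w" "w \<in> lists A"
    by (auto simp: carrier_presented_monoid)
  moreover from this have "u @ v \<in> lists A" "v @ w \<in> lists A" by auto
  ultimately show "X \<otimes>\<^bsub>presented_monoid A R\<^esub> Y \<otimes>\<^bsub>presented_monoid A R\<^esub> Z
      = X \<otimes>\<^bsub>presented_monoid A R\<^esub> (Y \<otimes>\<^bsub>presented_monoid A R\<^esub> Z)"
    by (simp only: mult_presented_monoid append_assoc)
next
  fix X Y
  assume "X \<in> carrier (presented_monoid A R)" "Y \<in> carrier (presented_monoid A R)"
  then obtain u v where *: "X = word_class A R u" "u \<in> lists A" "Y = word_class A R v" "v \<in> lists A"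
    by (auto simp: carrier_presented_monoid)
  then have "u @ v \<in> lists A" by auto
  then show "X \<otimes>\<^bsub>presented_monoid A R\<^esub> Y \<in> carrier (presented_monoid A R)"
    unfolding carrier_presented_monoid *(1,3) mult_presented_monoid[OF *(2,4)] by (rule imageI)
next
  have "[] \<in> lists A" by simp
  then show "\<one>\<^bsub>presented_monoid A R\<^esub> \<in> carrier (presented_monoid A R)"
    unfolding carrier_presented_monoid one_presented_monoid by (rule imageI)
next
  fix X assume "X \<in> carrier (presented_monoid A R)"
  then obtain u where "X = word_class A R u" "u \<in> lists A"
    by (auto simp: carrier_presented_monoid)
  then show "\<one>\<^bsub>presented_monoid A R\<^esub> \<otimes>\<^bsub>presented_monoid A R\<^esub> X = X"
    "X \<otimes>\<^bsub>presented_monoid A R\<^esub> \<one>\<^bsub>presented_monoid A R\<^esub> = X"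
    by (simp_all add: one_presented_monoid mult_presented_monoid)
qed

lemma word_class_relI:
  assumes "(u, v) \<in> R" "u \<in> lists A" "v \<in> lists A"
  shows "word_class A R u = word_class A R v"
  using word_cong.rel[OF assms, of "[]" "[]"] assms by (simp add: word_class_eq_iff)


section \<open>Forests\<close>

abbreviation empty_forest :: forest where "empty_forest \<equiv> (\<lambda>_. Leaf)"

section \<open>Left multiplication by a caret\<close>

text \<open>This is left multiplication by \<open>caret k\<close> (see
  \<open>caret_forest_mult\<close>), written without the leaf counts of
  \<open>forest_mult\<close>.\<close>

definition merge :: "nat \<Rightarrow> forest \<Rightarrow> forest" where
  "merge k E = (\<lambda>i. if i < k then E i else if i = k then Caret (E k) (E (k + 1)) else E (i + 1))"

lemma graft_Leaf: "graft t empty_forest = t"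
  by (induction t) auto

lemma leaves_pos: "1 \<le> leaves t"
  by (induction t) auto

lemma forest_carrier: "E \<in> carrier forest_monoid \<longleftrightarrow> E 0 = Leaf \<and> finite {i. E i \<noteq> Leaf}"
  by (simp add: forest_monoid_def)

lemma forest_one: "\<one>\<^bsub>forest_monoid\<^esub> = empty_forest"
  by (simp add: forest_monoid_def)

lemma forest_mult_eq: "E \<otimes>\<^bsub>forest_monoid\<^esub> F = forest_mult E F"
  by (simp add: forest_monoid_def)

lemma empty_forest_closed: "empty_forest \<in> carrier forest_monoid"
  by (simp add: forest_carrier)

lemma forest_mult_empty_left:
  assumes "F 0 = Leaf"
  shows "forest_mult empty_forest F = F"
  using assms by (auto simp: forest_mult_def)

lemma forest_mult_empty_right:
  assumes "F 0 = Leaf"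
  shows "forest_mult F empty_forest = F"
  using assms by (auto simp: forest_mult_def graft_Leaf)

lemma merge_closed:
  assumes "1 \<le> k" "E \<in> carrier forest_monoid"
  shows "merge k E \<in> carrier forest_monoid"
proof -
  have "{i. merge k E i \<noteq> Leaf} \<subseteq> insert k ({i. E i \<noteq> Leaf} \<union> (\<lambda>i. i - 1) ` {i. E i \<noteq> Leaf})"
  proof
    fix i assume "i \<in> {i. merge k E i \<noteq> Leaf}"
    then show "i \<in> insert k ({i. E i \<noteq> Leaf} \<union> (\<lambda>i. i - 1) ` {i. E i \<noteq> Leaf})"
      by (cases "i \<le> k") (auto simp: merge_def split: if_splits intro!: image_eqI[of _ _ "i + 1"])
  qed
  moreover have "finite (insert k ({i. E i \<noteq> Leaf} \<union> (\<lambda>i. i - 1) ` {i. E i \<noteq> Leaf}))"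
    using assms by (simp add: forest_carrier)
  ultimately have "finite {i. merge k E i \<noteq> Leaf}"
    by (rule finite_subset)
  moreover have "merge k E 0 = Leaf"
    using assms by (simp add: merge_def forest_carrier)
  ultimately show ?thesis
    by (simp add: forest_carrier)
qed

lemma merge_inject: "merge k E = merge k E' \<Longrightarrow> E = E'"
proof
  fix i
  assume eq: "merge k E = merge k E'"
  then have *: "merge k E j = merge k E' j" for j
    by simp
  consider "i < k" | "i = k" | "i = k + 1" | j where "i = j + 1" "k < j"
    by (metis Suc_eq_plus1 less_Suc_eq less_antisym linorder_neqE_nat not0_implies_Suc not_less_eq zero_less_Suc)
  then show "E i = E' i"
    using *[of k] *[of i] *[of "i - 1"] by cases (auto simp: merge_def)
qed

lemma merge_not_empty: "merge k E \<noteq> empty_forest"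
  by (auto simp: merge_def fun_eq_iff)

text \<open>The defining relation of the carets, read as an equality of left
  multiplications.\<close>

lemma merge_merge: "k < l \<Longrightarrow> merge l (merge k E) = merge k (merge (l + 1) E)"
  by (auto simp: merge_def fun_eq_iff)

text \<open>The common forest has root carets in two different trees, at \<open>k\<close> and at
  \<open>l\<close>. Removing one leaves the other in place, up to a shift of its index, so both can
  be removed and \<open>E''\<close> remains.\<close>

lemma merge_eq_mergeD:
  assumes eq: "merge k E = merge l E'" and kl: "1 \<le> k" "k < l"
    and E: "E \<in> carrier forest_monoid"
  obtains E'' where "E = merge (l + 1) E''" "E' = merge k E''" "E'' \<in> carrier forest_monoid"
proof
  \<comment> \<open>This is \<open>E\<close> without the root caret of its tree at
    \<open>l + 1\<close>. That tree is the tree at \<open>l\<close> of the common forest, so its two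
    subtrees are the trees of \<open>E'\<close> at \<open>l\<close> and
    \<open>l + 1\<close>.\<close>
  define E'' where "E'' = (\<lambda>i. if i \<le> l then E i else if i = l + 1 then E' l
     else if i = l + 2 then E' (l + 1) else E (i - 1))"
  have *: "merge k E j = merge l E' j" for j
    using eq by simp
  show "E = merge (l + 1) E''"
    using *[of l] kl by (auto simp: merge_def E''_def fun_eq_iff)
  show "E' = merge k E''"
  proof
    fix i
    consider "i < l" | "i = l" | "i = l + 1" | j where "i = j + 1" "l < j"
      by (metis Suc_eq_plus1 less_Suc_eq less_antisym linorder_neqE_nat not0_implies_Suc not_less_eq zero_less_Suc)
    then show "E' i = merge k E'' i"
      using *[of i] *[of "i - 1"] kl by cases (auto simp: merge_def E''_def)
  qed
  have "{i. E'' i \<noteq> Leaf} \<subseteq> {l + 1, l + 2} \<union> {i. E i \<noteq> Leaf} \<union> Suc ` {i. E i \<noteq> Leaf}"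
  proof
    fix i assume "i \<in> {i. E'' i \<noteq> Leaf}"
    then show "i \<in> {l + 1, l + 2} \<union> {i. E i \<noteq> Leaf} \<union> Suc ` {i. E i \<noteq> Leaf}"
      by (cases "i \<le> l") (auto simp: E''_def split: if_splits intro!: image_eqI[of _ _ "i - 1"])
  qed
  moreover have "finite ({l + 1, l + 2} \<union> {i. E i \<noteq> Leaf} \<union> Suc ` {i. E i \<noteq> Leaf})"
    using E by (simp add: forest_carrier)
  ultimately have "finite {i. E'' i \<noteq> Leaf}"
    by (rule finite_subset)
  moreover have "E'' 0 = Leaf"
    using E by (simp add: E''_def forest_carrier)
  ultimately show "E'' \<in> carrier forest_monoid"
    by (simp add: forest_carrier)
qed

text \<open>Joining two trees creates no leaves and loses none. Past \<open>k\<close>, the joined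
  tree accounts for two trees of \<open>E\<close>, hence the upper bound
  \<open>i + 1\<close>.\<close>

lemma sum_leaves_merge:
  assumes "1 \<le> k"
  shows "k < i \<Longrightarrow> (\<Sum>m = 1..<i. leaves (merge k E m)) = (\<Sum>m = 1..<i + 1. leaves (E m))"
    and "i \<le> k \<Longrightarrow> (\<Sum>m = 1..<i. leaves (merge k E m)) = (\<Sum>m = 1..<i. leaves (E m))"
proof -
  show 1: "i \<le> k \<Longrightarrow> (\<Sum>m = 1..<i. leaves (merge k E m)) = (\<Sum>m = 1..<i. leaves (E m))" for i
    by (intro sum.cong) (auto simp: merge_def)
  show "k < i \<Longrightarrow> (\<Sum>m = 1..<i. leaves (merge k E m)) = (\<Sum>m = 1..<i + 1. leaves (E m))"
  proof (induction i)
    case (Suc i)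
    show ?case
    proof (cases "i = k")
      case True
      then show ?thesis
        using assms 1[of k] by (simp add: merge_def)
    next
      case False
      then show ?thesis
        using assms Suc by (simp add: merge_def)
    qed
  qed simp
qed

text \<open>Associativity with a caret as the left factor. Since every forest is a product of
  carets, this yields associativity in general through concatenation of words.\<close>

lemma merge_forest_mult:
  assumes "1 \<le> k"
  shows "forest_mult (merge k E) F = merge k (forest_mult E F)"
proof
  fix i
  consider "i = 0" | "0 < i" "i < k" | "i = k" | "k < i"
    by linarith
  then show "forest_mult (merge k E) F i = merge k (forest_mult E F) i"
  proof cases
    case 3
    then show ?thesis
      using assms unfolding forest_mult_def sum_leaves_merge(2)[OF assms order.refl]
      by (simp add: merge_def forest_mult_def add_ac)
  next
    case 4
    then show ?thesis
      using assms unfolding forest_mult_def sum_leaves_merge(1)[OF assms 4]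
      by (simp add: merge_def forest_mult_def)
  next
    case 2
    then show ?thesis
      using assms unfolding forest_mult_def sum_leaves_merge(2)[OF assms less_imp_le[OF 2(2)]]
      by (simp add: merge_def forest_mult_def)
  qed (use assms in \<open>auto simp: merge_def forest_mult_def\<close>)
qed

lemma merge_empty: "merge k empty_forest = caret k"
  by (auto simp: merge_def caret_def)

lemma caret_closed: "1 \<le> k \<Longrightarrow> caret k \<in> carrier forest_monoid"
  using merge_closed[of k empty_forest] by (simp add: merge_empty empty_forest_closed)

lemma caret_forest_mult:
  assumes "1 \<le> k" "F 0 = Leaf"
  shows "forest_mult (caret k) F = merge k F"
  using merge_forest_mult[OF assms(1), of empty_forest F] assms
  by (simp add: merge_empty forest_mult_empty_left)


subsection \<open>Words in the carets\<close>

definition forest_of :: "nat list \<Rightarrow> forest" where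
  "forest_of w = foldr merge w empty_forest"

lemma forest_of_simps [simp]:
  "forest_of [] = empty_forest"
  "forest_of (k # w) = merge k (forest_of w)"
  by (simp_all add: forest_of_def)

abbreviation pos_word :: "nat list \<Rightarrow> bool" where
  "pos_word w \<equiv> 0 \<notin> set w"

text \<open>\<open>valid n w\<close>: the carets of \<open>w\<close> can be attached one after another to the
  feet of a semisimple forest with \<open>n\<close> feet.\<close>

primrec valid :: "nat \<Rightarrow> nat list \<Rightarrow> bool" where
  "valid n [] \<longleftrightarrow> True"
| "valid n (k # w) \<longleftrightarrow> 1 \<le> k \<and> k \<le> n \<and> valid (n + 1) w"

lemma valid_pos: "valid n w \<Longrightarrow> pos_word w"
  by (induction w arbitrary: n) auto

lemma valid_mono: "valid m w \<Longrightarrow> m \<le> n \<Longrightarrow> valid n w"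
  by (induction w arbitrary: m n) (auto intro: le_trans)

lemma valid_append: "valid n (u @ v) \<longleftrightarrow> valid n u \<and> valid (n + length u) v"
  by (induction u arbitrary: n) auto

lemma pos_word_valid: "pos_word w \<Longrightarrow> \<exists>n. valid n w"
proof (induction w)
  case (Cons k w)
  then obtain n where "valid n w" by auto
  then show ?case
    using Cons.prems by (auto intro!: exI[of _ "max k n"] valid_mono[of n w])
qed simp

lemma forest_of_closed: "pos_word w \<Longrightarrow> forest_of w \<in> carrier forest_monoid"
  by (induction w) (auto simp: empty_forest_closed intro!: merge_closed)

lemma forest_of_append:
  "pos_word u \<Longrightarrow> pos_word v \<Longrightarrow> forest_of (u @ v) = forest_mult (forest_of u) (forest_of v)"
proof (induction u)
  case Nil
  then show ?case
    using forest_of_closed[of v] by (simp add: forest_mult_empty_left forest_carrier)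
next
  case (Cons k u)
  then show ?case
    by (simp add: merge_forest_mult)
qed

text \<open>If \<open>E n\<close> is trivial, lower \<open>n\<close>; otherwise split off the root
  caret of \<open>E n\<close>, which leaves a forest supported on one tree more. Tracking the
  support gives validity of the word along with its existence.\<close>

lemma forest_of_valid:
  "E 0 = Leaf \<Longrightarrow> \<forall>i>n. E i = Leaf \<Longrightarrow> \<exists>w. valid n w \<and> forest_of w = E"
\<comment> \<open>A tree with \<open>leaves (E i)\<close> leaves has one caret fewer. Carets are
  weighted twice because splitting one off raises \<open>n\<close> by one.\<close>
proof (induction "2 * (\<Sum>i\<le>n. leaves (E i) - 1) + n" arbitrary: n E rule: less_induct)
  case less
  show ?case
  proof (cases n)
    case 0
    then have "E = empty_forest"
      using less.prems by (auto simp: fun_eq_iff) (metis gr0I)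
    then show ?thesis
      by (intro exI[of _ "[]"]) simp
  next
    case (Suc m)
    show ?thesis
    proof (cases "E n")
      case Leaf
      then have *: "\<forall>i>m. E i = Leaf"
        using less.prems Suc by (metis not_less_eq linorder_neqE_nat)
      have "(\<Sum>i\<le>n. leaves (E i) - 1) = (\<Sum>i\<le>m. leaves (E i) - 1)"
        using Leaf Suc by simp
      then obtain w where "valid m w" "forest_of w = E"
        using less.hyps[OF _ less.prems(1) *] Suc by auto
      then show ?thesis
        using Suc valid_mono[of m w n] by auto
    next
      case (Caret s t)
      define E' where "E' = E(n := s, n + 1 := t)"
      have "(\<Sum>i\<le>n + 1. leaves (E' i) - 1) = (\<Sum>i<n. leaves (E i) - 1) + (leaves s - 1) + (leaves t - 1)"
        by (simp add: E'_def flip: lessThan_Suc_atMost)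
      moreover have "(\<Sum>i\<le>n. leaves (E i) - 1) = (\<Sum>i<n. leaves (E i) - 1) + (leaves s + leaves t - 1)"
        using Caret by (simp flip: lessThan_Suc_atMost)
      ultimately have "2 * (\<Sum>i\<le>n + 1. leaves (E' i) - 1) + (n + 1) < 2 * (\<Sum>i\<le>n. leaves (E i) - 1) + n"
        using leaves_pos[of s] leaves_pos[of t] by linarith
      moreover have "E' 0 = Leaf" "\<forall>i>n + 1. E' i = Leaf"
        using less.prems Suc by (auto simp: E'_def)
      ultimately obtain w where w: "valid (n + 1) w" "forest_of w = E'"
        using less.hyps by blast
      have "merge n E' = E"
        using Caret less.prems by (auto simp: E'_def merge_def fun_eq_iff)
      then show ?thesis
        using w Suc by (intro exI[of _ "n # w"]) auto
    qed
  qed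
qed

lemma forest_of_surj:
  assumes "E \<in> carrier forest_monoid"
  obtains w where "pos_word w" "forest_of w = E"
proof -
  obtain n where "\<forall>i\<in>{i. E i \<noteq> Leaf}. i \<le> n"
    using assms finite_nat_set_iff_bounded_le by (auto simp: forest_carrier)
  then have "\<forall>i>n. E i = Leaf"
    by (metis (mono_tags, lifting) linorder_not_less mem_Collect_eq)
  then show ?thesis
    using that forest_of_valid[of E n] assms valid_pos by (auto simp: forest_carrier)
qed

lemma monoid_forest_monoid: "monoid forest_monoid"
proof (rule monoidI)
  fix E F assume EF: "E \<in> carrier forest_monoid" "F \<in> carrier forest_monoid"
  obtain u where u: "pos_word u" "forest_of u = E" using EF by (elim forest_of_surj)
  obtain v where v: "pos_word v" "forest_of v = F" using EF by (elim forest_of_surj)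
  show "E \<otimes>\<^bsub>forest_monoid\<^esub> F \<in> carrier forest_monoid"
    using forest_of_append[OF u(1) v(1)] forest_of_closed[of "u @ v"] u v by (simp add: forest_mult_eq)
next
  fix E F H
  assume A: "E \<in> carrier forest_monoid" "F \<in> carrier forest_monoid" "H \<in> carrier forest_monoid"
  obtain u where u: "pos_word u" "forest_of u = E" using A by (elim forest_of_surj)
  obtain v where v: "pos_word v" "forest_of v = F" using A by (elim forest_of_surj)
  obtain w where w: "pos_word w" "forest_of w = H" using A by (elim forest_of_surj)
  show "E \<otimes>\<^bsub>forest_monoid\<^esub> F \<otimes>\<^bsub>forest_monoid\<^esub> H = E \<otimes>\<^bsub>forest_monoid\<^esub> (F \<otimes>\<^bsub>forest_monoid\<^esub> H)"
    using u v w by (auto simp: forest_mult_eq simp flip: u(2) v(2) w(2) forest_of_append)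
qed (auto simp: forest_one forest_mult_eq forest_carrier forest_mult_empty_left forest_mult_empty_right)

text \<open>The carets of \<open>E\<close> are removed one at a time, each by injectivity of
  \<open>merge k\<close>.\<close>

lemma forest_l_cancel:
  assumes "E \<in> carrier forest_monoid" "forest_mult E F = forest_mult E F'" "F 0 = Leaf" "F' 0 = Leaf"
  shows "F = F'"
proof -
  obtain u where u: "pos_word u" "forest_of u = E" using assms(1) by (elim forest_of_surj)
  have "forest_mult (forest_of u) F = forest_mult (forest_of u) F' \<Longrightarrow> F = F'"
    using u(1)
    by (induction u) (auto simp: forest_mult_empty_left assms(3,4) merge_forest_mult dest: merge_inject)
  then show ?thesis
    using u assms by simp
qed

section \<open>Common right multiples of caret words\<close>

text \<open>A single caret is moved past the letters of \<open>w\<close>: its index grows by one at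
  each smaller letter, while larger letters grow by one themselves. If it meets its own index it is
  absorbed and \<open>w'\<close> is empty. Lengths and validity are recorded in order to count feet
  later.\<close>

lemma word_strip:
  "valid n w \<Longrightarrow> 1 \<le> l \<Longrightarrow> l \<le> n \<Longrightarrow> \<exists>w' v'. valid (n + length w) w' \<and> valid (n + 1) v'
     \<and> length w + length w' = 1 + length v' \<and> forest_of (w @ w') = forest_of (l # v')"
proof (induction w arbitrary: n l)
  case Nil
  then show ?case
    by (intro exI[of _ "[l]"] exI[of _ "[]"]) auto
next
  case (Cons k w)
  consider "k = l" | "k < l" | "l < k" by linarith
  then show ?case
  proof cases
    case 1
    then show ?thesis
      using Cons.prems by (intro exI[of _ "[]"] exI[of _ w]) auto
  next
    case 2
    then obtain w' v' where *: "valid (n + 1 + length w) w'" "valid (n + 2) v'" "length w + length w' = 1 + length v'"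
      "forest_of (w @ w') = forest_of ((l + 1) # v')"
      using Cons.IH[of "n + 1" "l + 1"] Cons.prems by auto
    then show ?thesis
      using 2 Cons.prems merge_merge[of k l] by (intro exI[of _ w'] exI[of _ "k # v'"]) auto
  next
    case 3
    then obtain w' v' where *: "valid (n + 1 + length w) w'" "valid (n + 2) v'" "length w + length w' = 1 + length v'"
      "forest_of (w @ w') = forest_of (l # v')"
      using Cons.IH[of "n + 1" "l"] Cons.prems by auto
    then show ?thesis
      using 3 Cons.prems merge_merge[of l k] by (intro exI[of _ w'] exI[of _ "(k + 1) # v'"]) auto
  qed
qed

text \<open>The strip argument repeated over the letters of \<open>v\<close>:
  \<open>word_strip\<close> brings the first letter \<open>l\<close> to the front of a multiple of
  \<open>w\<close>, and the remainders \<open>v'\<close> and \<open>v\<close> then have a common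
  multiple by induction, starting with one more foot.\<close>

lemma forest_of_common_multiple:
  "valid n w \<Longrightarrow> valid n v \<Longrightarrow> \<exists>w' v'. valid (n + length w) w' \<and> valid (n + length v) v'
     \<and> length w + length w' = length v + length v' \<and> forest_of (w @ w') = forest_of (v @ v')"
proof (induction v arbitrary: n w)
  case Nil
  then show ?case
    by (intro exI[of _ "[]"] exI[of _ w]) auto
next
  case (Cons l v)
  obtain w' v' where 1: "valid (n + length w) w'" "valid (n + 1) v'"
    "length w + length w' = 1 + length v'" "forest_of (w @ w') = forest_of (l # v')"
    using word_strip[of n w l] Cons.prems by auto
  obtain x y where 2: "valid (n + 1 + length v') x" "valid (n + 1 + length v) y"
    "length v' + length x = length v + length y" "forest_of (v' @ x) = forest_of (v @ y)"
    using Cons.IH[OF 1(2)] Cons.prems by auto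
  have pos: "pos_word w" "pos_word w'" "pos_word v'" "pos_word x"
    using 1 2 Cons.prems valid_pos by blast+
  have "n + length w + length w' = n + 1 + length v'"
    using 1(3) by simp
  then have "valid (n + length w + length w') x"
    using 2(1) by (simp only:)
  then have "valid (n + length w) (w' @ x)"
    using 1(1) by (simp add: valid_append)
  moreover have "forest_of (w @ w' @ x) = forest_of ((l # v) @ y)"
  proof -
    have "forest_of (w @ w' @ x) = forest_mult (forest_of (w @ w')) (forest_of x)"
      using forest_of_append[of "w @ w'" x] pos by simp
    also have "\<dots> = forest_of (l # v' @ x)"
      unfolding 1(4) using forest_of_append[of "l # v'" x] pos Cons.prems by simp
    finally show ?thesis
      by (simp add: 2(4))
  qed
  ultimately show ?case
    using 1(3) 2(2,3) by (intro exI[of _ "w' @ x"] exI[of _ y]) auto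
qed

section \<open>Feet of semisimple forests\<close>

lemma leaves_graft: "leaves (graft t f) = (\<Sum>j = 1..leaves t. leaves (f j))"
proof (induction t arbitrary: f)
  case (Caret s t)
  have "(\<Sum>j = 1..leaves s + leaves t. leaves (f j)) =
      (\<Sum>j = 1..leaves s. leaves (f j)) + (\<Sum>j = leaves s + 1..leaves s + leaves t. leaves (f j))"
    using leaves_pos by (subst sum.ub_add_nat) auto
  also have "(\<Sum>j = leaves s + 1..leaves s + leaves t. leaves (f j)) = (\<Sum>j = 1..leaves t. leaves (f (j + leaves s)))"
    using sum.shift_bounds_cl_nat_ivl[of "\<lambda>j. leaves (f j)" 1 "leaves s" "leaves t"] by (simp add: add_ac)
  finally show ?case
    by (simp add: Caret)
qed simp

lemma semisimple_empty: "semisimple 1 empty_forest"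
  by (simp add: semisimple_def empty_forest_closed)

lemma semisimple_mult_caret:
  assumes "semisimple n E" "1 \<le> k" "k \<le> n"
  shows "semisimple (n + 1) (forest_mult E (caret k))"
proof -
  have E: "E \<in> carrier forest_monoid" "\<forall>i>1. E i = Leaf" "leaves (E 1) = n"
    using assms by (auto simp: semisimple_def)
  have "leaves (graft (E 1) (caret k)) = (\<Sum>j = 1..n. 1 + (if j = k then 1 else 0))"
    unfolding leaves_graft E by (intro sum.cong) (auto simp: caret_def)
  also have "\<dots> = n + 1"
    using assms by (subst sum.distrib) (simp add: sum.delta)
  finally have "leaves (forest_mult E (caret k) 1) = n + 1"
    by (simp add: forest_mult_def)
  moreover have "forest_mult E (caret k) i = Leaf" if "i > 1" for i
  proof -
    \<comment> \<open>A later tree of the product is the tree of \<open>caret k\<close> at an index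
      exceeding this sum by one. As the first tree already uses \<open>n \<ge> k\<close> positions,
      that tree is trivial.\<close>
    have "n \<le> (\<Sum>m = 1..<i. leaves (E m))"
      using that E member_le_sum[of 1 "{1..<i}" "\<lambda>m. leaves (E m)"] by auto
    then show ?thesis
      using that E assms by (auto simp: forest_mult_def caret_def)
  qed
  ultimately show ?thesis
    using monoid.m_closed[OF monoid_forest_monoid E(1) caret_closed[OF assms(2)]]
    by (simp add: semisimple_def forest_mult_eq)
qed

lemma semisimple_mult:
  "semisimple n E \<Longrightarrow> valid n w \<Longrightarrow> semisimple (n + length w) (forest_mult E (forest_of w))"
proof (induction w arbitrary: n E)
  case Nil
  then show ?case
    by (simp add: forest_mult_empty_right semisimple_def forest_carrier)
next
  case (Cons k w)
  have E: "E \<in> carrier forest_monoid" "pos_word w" "1 \<le> k" "k \<le> n"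
    using Cons.prems valid_pos by (auto simp: semisimple_def)
  then have F: "forest_of w \<in> carrier forest_monoid"
    by (simp add: forest_of_closed)
  have "forest_mult E (forest_of (k # w)) = forest_mult E (forest_mult (caret k) (forest_of w))"
    using E F by (simp add: caret_forest_mult forest_carrier)
  also have "\<dots> = forest_mult (forest_mult E (caret k)) (forest_of w)"
    using monoid.m_assoc[OF monoid_forest_monoid E(1) caret_closed F] E by (simp add: forest_mult_eq)
  finally show ?case
    using Cons.IH[OF semisimple_mult_caret] Cons.prems by simp
qed

lemma semisimple_forest_of: "valid 1 w \<Longrightarrow> semisimple (1 + length w) (forest_of w)"
  using semisimple_mult[OF semisimple_empty, of w] forest_of_closed[OF valid_pos, of 1 w]
  by (simp add: forest_mult_empty_left forest_carrier)

lemma semisimple_unique: "semisimple m E \<Longrightarrow> semisimple n E \<Longrightarrow> m = n"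
  by (simp add: semisimple_def)

lemma semisimpleE:
  assumes "semisimple n E"
  obtains w where "valid 1 w" "forest_of w = E" "n = 1 + length w"
proof -
  obtain w where w: "valid 1 w" "forest_of w = E"
    using forest_of_valid[of E 1] assms by (auto simp: semisimple_def forest_carrier)
  then show ?thesis
    using that semisimple_forest_of[OF w(1)] semisimple_unique assms by blast
qed

lemma semisimple_exists:
  assumes "1 \<le> n"
  obtains E where "semisimple n E"
proof
  \<comment> \<open>Always attaching the next caret to the first foot gives a semisimple forest with
    any prescribed number of feet.\<close>
  have "valid m (replicate k 1)" if "1 \<le> m" for m k
    using that by (induction k arbitrary: m) auto
  then show "semisimple n (forest_of (replicate (n - 1) 1))"
    using assms semisimple_forest_of[of "replicate (n - 1) 1"] by simp
qed


section \<open>The direct limit of a cloning system\<close>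

context injective_directed_system
begin

lemma \<iota>_closed: "1 \<le> m \<Longrightarrow> m \<le> n \<Longrightarrow> g \<in> carrier (G m) \<Longrightarrow> \<iota> m n g \<in> carrier (G n)"
  using \<iota>_hom by (auto simp: hom_def)

lemma equiv_lim_rel: "equiv (SIGMA n:{1..}. carrier (G n)) (lim_rel G \<iota>)"
proof (rule equivI)
  show "lim_rel G \<iota> \<subseteq> (SIGMA n:{1..}. carrier (G n)) \<times> (SIGMA n:{1..}. carrier (G n))"
    by (auto simp: lim_rel_def)
  show "refl_on (SIGMA n:{1..}. carrier (G n)) (lim_rel G \<iota>)"
    by (auto intro!: refl_onI simp: lim_rel_def)
  show "sym (lim_rel G \<iota>)"
    by (rule symI) (auto simp: lim_rel_def, metis)
  show "trans (lim_rel G \<iota>)"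
  proof (rule transI, clarify)
    fix k f m g n h
    assume "((k, f), (m, g)) \<in> lim_rel G \<iota>" "((m, g), (n, h)) \<in> lim_rel G \<iota>"
    then obtain a b where *: "1 \<le> k" "1 \<le> m" "1 \<le> n"
      "f \<in> carrier (G k)" "g \<in> carrier (G m)" "h \<in> carrier (G n)"
      "k \<le> a" "m \<le> a" "\<iota> k a f = \<iota> m a g" "m \<le> b" "n \<le> b" "\<iota> m b g = \<iota> n b h"
      by (auto simp: lim_rel_def)
    have "\<iota> k (max a b) f = \<iota> a (max a b) (\<iota> k a f)"
      using *(1,4,7) by (simp add: \<iota>_comp)
    also have "\<dots> = \<iota> b (max a b) (\<iota> m b g)"
      unfolding *(9) using *(2,5,8,10) by (simp add: \<iota>_comp)
    also have "\<dots> = \<iota> n (max a b) h"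
      unfolding *(12) using *(3,6,11) by (simp add: \<iota>_comp)
    finally show "((k, f), (n, h)) \<in> lim_rel G \<iota>"
      using * by (auto simp: lim_rel_def intro!: exI[of _ "max a b"])
  qed
qed

lemma lim_in_eq_iff:
  assumes "1 \<le> m" "1 \<le> n" "g \<in> carrier (G m)" "h \<in> carrier (G n)"
  shows "lim_in G \<iota> m g = lim_in G \<iota> n h \<longleftrightarrow> (\<exists>l. m \<le> l \<and> n \<le> l \<and> \<iota> m l g = \<iota> n l h)"
proof -
  have "lim_in G \<iota> m g = lim_in G \<iota> n h \<longleftrightarrow> ((m, g), (n, h)) \<in> lim_rel G \<iota>"
    unfolding lim_in_def using assms by (intro eq_equiv_class_iff[OF equiv_lim_rel]) auto
  then show ?thesis
    using assms by (auto simp: lim_rel_def)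
qed

lemma in_lim_in_iff:
  assumes "1 \<le> m" "g \<in> carrier (G m)"
  shows "(n, h) \<in> lim_in G \<iota> m g \<longleftrightarrow> 1 \<le> n \<and> h \<in> carrier (G n) \<and> lim_in G \<iota> n h = lim_in G \<iota> m g"
  using equiv_class_eq_iff[OF equiv_lim_rel, of "(m, g)" "(n, h)"] assms by (auto simp: lim_in_def)

lemma lim_in_\<iota>:
  assumes "1 \<le> m" "m \<le> n" "g \<in> carrier (G m)"
  shows "lim_in G \<iota> n (\<iota> m n g) = lim_in G \<iota> m g"
  using assms \<iota>_closed[OF assms]
  by (subst lim_in_eq_iff) (auto simp: \<iota>_id intro!: exI[of _ n])

lemma lim_in_inject:
  assumes "1 \<le> n" "g \<in> carrier (G n)" "h \<in> carrier (G n)" "lim_in G \<iota> n g = lim_in G \<iota> n h"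
  shows "g = h"
proof -
  obtain l where "n \<le> l" "\<iota> n l g = \<iota> n l h"
    using assms by (auto simp: lim_in_eq_iff)
  then show ?thesis
    using \<iota>_inj[of n l] assms by (auto dest: inj_onD)
qed

lemma carrier_lim_group:
  "carrier (lim_group G \<iota>) = {lim_in G \<iota> n g |n g. 1 \<le> n \<and> g \<in> carrier (G n)}"
  by (auto simp: lim_group_def quotient_def lim_in_def)

lemma lim_in_closed: "1 \<le> n \<Longrightarrow> g \<in> carrier (G n) \<Longrightarrow> lim_in G \<iota> n g \<in> carrier (lim_group G \<iota>)"
  by (auto simp: carrier_lim_group)

text \<open>Finitely many elements of the limit always have representatives in a common stage, which may be
  taken as large as desired; this reduces all identities in the limit to those in one group.\<close>

lemma lim_rep:
  assumes "X \<in> carrier (lim_group G \<iota>)"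
  obtains n where "1 \<le> n" "\<forall>l\<ge>n. \<exists>g\<in>carrier (G l). X = lim_in G \<iota> l g"
proof -
  obtain n g where "1 \<le> n" "g \<in> carrier (G n)" "X = lim_in G \<iota> n g"
    using assms by (auto simp: carrier_lim_group)
  then show ?thesis
    using that[of n] lim_in_\<iota> \<iota>_closed by metis
qed

lemma lim_rep1:
  assumes "X \<in> carrier (lim_group G \<iota>)"
  obtains n g where "1 \<le> n" "k \<le> n" "g \<in> carrier (G n)" "X = lim_in G \<iota> n g"
proof -
  obtain n where n: "1 \<le> n" "\<forall>l\<ge>n. \<exists>g\<in>carrier (G l). X = lim_in G \<iota> l g"
    using lim_rep[OF assms] .
  show ?thesis
    using that[of "max n k"] n(1) n(2)[rule_format, of "max n k"] by auto
qed

lemma lim_rep2: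
  assumes "X \<in> carrier (lim_group G \<iota>)" "Y \<in> carrier (lim_group G \<iota>)"
  obtains n g h where "1 \<le> n" "k \<le> n" "g \<in> carrier (G n)" "h \<in> carrier (G n)"
    "X = lim_in G \<iota> n g" "Y = lim_in G \<iota> n h"
proof -
  obtain m where m: "1 \<le> m" "\<forall>l\<ge>m. \<exists>g\<in>carrier (G l). X = lim_in G \<iota> l g"
    using lim_rep[OF assms(1)] .
  obtain n where n: "1 \<le> n" "\<forall>l\<ge>n. \<exists>g\<in>carrier (G l). Y = lim_in G \<iota> l g"
    using lim_rep[OF assms(2)] .
  show ?thesis
    using that[of "max (max m n) k"] m(1)
      m(2)[rule_format, of "max (max m n) k"] n(2)[rule_format, of "max (max m n) k"]
    by (meson dual_order.trans max.cobounded1 max.cobounded2)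
qed

lemma lim_mult:
  assumes n: "1 \<le> n" and gh: "g \<in> carrier (G n)" "h \<in> carrier (G n)"
  shows "lim_in G \<iota> n g \<otimes>\<^bsub>lim_group G \<iota>\<^esub> lim_in G \<iota> n h = lim_in G \<iota> n (g \<otimes>\<^bsub>G n\<^esub> h)"
proof -
  have *: "lim_in G \<iota> (max a b) (\<iota> a (max a b) g' \<otimes>\<^bsub>G (max a b)\<^esub> \<iota> b (max a b) h')
      = lim_in G \<iota> n (g \<otimes>\<^bsub>G n\<^esub> h)"
    if "(a, g') \<in> lim_in G \<iota> n g" "(b, h') \<in> lim_in G \<iota> n h" for a b g' h'
  proof -
    have A: "1 \<le> a" "g' \<in> carrier (G a)" "lim_in G \<iota> a g' = lim_in G \<iota> n g"
      and B: "1 \<le> b" "h' \<in> carrier (G b)" "lim_in G \<iota> b h' = lim_in G \<iota> n h"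
      using that n gh by (auto simp: in_lim_in_iff)
    \<comment> \<open>At a stage beyond all three indices the representatives of each factor
      coincide, by \<open>lim_in_inject\<close>. The transition maps are homomorphisms, so the
      products coincide there too.\<close>
    define l where "l = max n (max a b)"
    have l: "n \<le> l" "a \<le> l" "b \<le> l" "max a b \<le> l"
      by (auto simp: l_def)
    have "lim_in G \<iota> l (\<iota> a l g') = lim_in G \<iota> l (\<iota> n l g)"
      "lim_in G \<iota> l (\<iota> b l h') = lim_in G \<iota> l (\<iota> n l h)"
      using A B l n gh by (simp_all add: lim_in_\<iota>)
    then have eq: "\<iota> a l g' = \<iota> n l g" "\<iota> b l h' = \<iota> n l h"
      using A B l n gh \<iota>_closed by (auto intro!: lim_in_inject[of l])
    let ?p = "\<iota> a (max a b) g' \<otimes>\<^bsub>G (max a b)\<^esub> \<iota> b (max a b) h'"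
    have C: "\<iota> a (max a b) g' \<in> carrier (G (max a b))" "\<iota> b (max a b) h' \<in> carrier (G (max a b))"
      using A B \<iota>_closed by auto
    have ab: "1 \<le> max a b" using A by auto
    then interpret Gab: group "G (max a b)" by (rule group_G)
    have "lim_in G \<iota> (max a b) ?p = lim_in G \<iota> l (\<iota> (max a b) l ?p)"
      using C ab l by (intro lim_in_\<iota>[symmetric]) auto
    also have "\<iota> (max a b) l ?p = \<iota> a l g' \<otimes>\<^bsub>G l\<^esub> \<iota> b l h'"
      using hom_mult[OF \<iota>_hom[OF ab l(4)] C] A B l by (simp add: \<iota>_comp)
    also have "\<dots> = \<iota> n l (g \<otimes>\<^bsub>G n\<^esub> h)"
      using hom_mult[OF \<iota>_hom[OF n l(1)] gh] by (simp add: eq)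
    also have "lim_in G \<iota> l \<dots> = lim_in G \<iota> n (g \<otimes>\<^bsub>G n\<^esub> h)"
      using n l gh group.is_monoid[OF group_G[OF n]] by (intro lim_in_\<iota>) (auto intro: monoid.m_closed)
    finally show ?thesis .
  qed
  have "(n, g) \<in> lim_in G \<iota> n g" "(n, h) \<in> lim_in G \<iota> n h"
    using n gh by (auto simp: in_lim_in_iff)
  then have "(\<Union>(a, g')\<in>lim_in G \<iota> n g. \<Union>(b, h')\<in>lim_in G \<iota> n h.
      lim_in G \<iota> (max a b) (\<iota> a (max a b) g' \<otimes>\<^bsub>G (max a b)\<^esub> \<iota> b (max a b) h'))
      = lim_in G \<iota> n (g \<otimes>\<^bsub>G n\<^esub> h)"
    using * by fast
  then show ?thesis
    by (simp add: lim_group_def)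
qed

lemma lim_one:
  assumes "1 \<le> n"
  shows "\<one>\<^bsub>lim_group G \<iota>\<^esub> = lim_in G \<iota> n \<one>\<^bsub>G n\<^esub>"
proof -
  have "\<iota> 1 n \<one>\<^bsub>G 1\<^esub> = \<one>\<^bsub>G n\<^esub>"
    using assms group_G \<iota>_hom by (intro hom_one) auto
  moreover have "\<one>\<^bsub>G 1\<^esub> \<in> carrier (G 1)"
    using group_G[of 1] by (simp add: group.is_monoid monoid.one_closed)
  ultimately show ?thesis
    using lim_in_\<iota>[of 1 n "\<one>\<^bsub>G 1\<^esub>"] assms by (simp add: lim_group_def)
qed

lemma group_lim_group: "group (lim_group G \<iota>)"
proof (rule groupI)
  fix X Y assume "X \<in> carrier (lim_group G \<iota>)" "Y \<in> carrier (lim_group G \<iota>)"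
  then obtain n g h where *: "1 \<le> n" "g \<in> carrier (G n)" "h \<in> carrier (G n)"
    "X = lim_in G \<iota> n g" "Y = lim_in G \<iota> n h"
    by (rule lim_rep2[where k = 1])
  then interpret Gn: group "G n" by (simp add: group_G)
  show "X \<otimes>\<^bsub>lim_group G \<iota>\<^esub> Y \<in> carrier (lim_group G \<iota>)"
    using * by (simp add: lim_mult lim_in_closed)
next
  fix X Y Z
  assume A: "X \<in> carrier (lim_group G \<iota>)" "Y \<in> carrier (lim_group G \<iota>)" "Z \<in> carrier (lim_group G \<iota>)"
  obtain k where k: "1 \<le> k" "\<forall>l\<ge>k. \<exists>g\<in>carrier (G l). Z = lim_in G \<iota> l g"
    using lim_rep[OF A(3)] .
  obtain n g h where *: "1 \<le> n" "k \<le> n" "g \<in> carrier (G n)" "h \<in> carrier (G n)"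
    "X = lim_in G \<iota> n g" "Y = lim_in G \<iota> n h"
    using A(1,2) by (rule lim_rep2)
  obtain f where f: "f \<in> carrier (G n)" "Z = lim_in G \<iota> n f"
    using k *(2) by blast
  interpret Gn: group "G n" using * by (simp add: group_G)
  show "X \<otimes>\<^bsub>lim_group G \<iota>\<^esub> Y \<otimes>\<^bsub>lim_group G \<iota>\<^esub> Z = X \<otimes>\<^bsub>lim_group G \<iota>\<^esub> (Y \<otimes>\<^bsub>lim_group G \<iota>\<^esub> Z)"
    using * f by (simp add: lim_mult Gn.m_assoc)
next
  have "\<one>\<^bsub>G 1\<^esub> \<in> carrier (G 1)"
    using group_G[of 1] by (simp add: group.is_monoid monoid.one_closed)
  then show "\<one>\<^bsub>lim_group G \<iota>\<^esub> \<in> carrier (lim_group G \<iota>)"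
    by (simp add: lim_one[of 1] lim_in_closed)
next
  fix X assume "X \<in> carrier (lim_group G \<iota>)"
  then obtain n g where *: "1 \<le> n" "g \<in> carrier (G n)" "X = lim_in G \<iota> n g"
    by (rule lim_rep1[where k = 1])
  interpret Gn: group "G n" using * by (simp add: group_G)
  show "\<one>\<^bsub>lim_group G \<iota>\<^esub> \<otimes>\<^bsub>lim_group G \<iota>\<^esub> X = X"
    using * by (simp add: lim_one lim_mult)
  show "\<exists>Y\<in>carrier (lim_group G \<iota>). Y \<otimes>\<^bsub>lim_group G \<iota>\<^esub> X = \<one>\<^bsub>lim_group G \<iota>\<^esub>"
    using * by (intro bexI[of _ "lim_in G \<iota> n (inv\<^bsub>G n\<^esub> g)"]) (simp_all add: lim_one lim_mult lim_in_closed)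
qed

lemma lim_in_hom: "1 \<le> n \<Longrightarrow> lim_in G \<iota> n \<in> hom (G n) (lim_group G \<iota>)"
  by (auto intro!: homI simp: lim_in_closed lim_mult)

end

section \<open>Induced permutations and cloning maps on the direct limit\<close>

context cloning_system
begin

abbreviation L :: "(nat \<times> 'a) set monoid" where "L \<equiv> lim_group G \<iota>"
abbreviation r :: "(nat \<times> 'a) set \<Rightarrow> nat \<Rightarrow> nat" where "r \<equiv> lim_\<rho> \<rho>"
abbreviation K :: "nat \<Rightarrow> (nat \<times> 'a) set \<Rightarrow> (nat \<times> 'a) set" where "K \<equiv> lim_\<kappa> G \<iota> \<kappa>"

definition stage :: "nat \<Rightarrow> (nat \<times> 'a) set set" where
  "stage n = lim_in G \<iota> n ` carrier (G n)"

lemma stage_subset: "1 \<le> n \<Longrightarrow> stage n \<subseteq> carrier L"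
  by (auto simp: stage_def lim_in_closed)

lemma stage_mult: "1 \<le> n \<Longrightarrow> g \<in> stage n \<Longrightarrow> h \<in> stage n \<Longrightarrow> g \<otimes>\<^bsub>L\<^esub> h \<in> stage n"
  using group.is_monoid[OF group_G] by (auto simp: stage_def lim_mult monoid.m_closed)

lemma stage_inv:
  assumes "1 \<le> n" "g \<in> stage n"
  shows "inv\<^bsub>L\<^esub> g \<in> stage n"
proof -
  interpret group_hom "G n" L "lim_in G \<iota> n"
    using assms group_G group_lim_group lim_in_hom by (auto intro!: group_hom.intro group_hom_axioms.intro)
  show ?thesis
    using assms(2) by (auto simp: stage_def simp flip: hom_inv)
qed

lemma lim_\<rho>_lim_in:
  assumes "1 \<le> n" "g \<in> carrier (G n)"
  shows "r (lim_in G \<iota> n g) = \<rho> n g"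
proof -
  have "\<rho> m h = \<rho> n g" if "(m, h) \<in> lim_in G \<iota> n g" for m h
  proof -
    have m: "1 \<le> m" "h \<in> carrier (G m)" "lim_in G \<iota> m h = lim_in G \<iota> n g"
      using that assms by (auto simp: in_lim_in_iff)
    then obtain l where "m \<le> l" "n \<le> l" "\<iota> m l h = \<iota> n l g"
      using assms by (auto simp: lim_in_eq_iff)
    then show ?thesis
      using \<rho>_\<iota>[of m l h] \<rho>_\<iota>[of n l g] m assms by simp
  qed
  moreover have "(n, g) \<in> lim_in G \<iota> n g"
    using assms by (simp add: in_lim_in_iff)
  ultimately show ?thesis
    unfolding lim_\<rho>_def by (intro the_equality) blast+
qed

lemma lim_\<kappa>_lim_in:
  assumes n: "1 \<le> k" "k \<le> n" and g: "g \<in> carrier (G n)"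
  shows "K k (lim_in G \<iota> n g) = lim_in G \<iota> (n + 1) (\<kappa> n k g)"
proof -
  let ?f = "\<lambda>m h. if k \<le> m then \<kappa> m k h else \<iota> m (m + 1) h"
  \<comment> \<open>Cloning at a late stage \<open>l \<ge> k\<close> computes the value for every
    earlier representative; the two compatibility laws of \<open>\<kappa>\<close> with
    \<open>\<iota>\<close> cover the cases \<open>k \<le> m\<close> and
    \<open>m < k\<close>.\<close>
  have f: "lim_in G \<iota> (l + 1) (\<kappa> l k (\<iota> m l h)) = lim_in G \<iota> (m + 1) (?f m h)"
    if "1 \<le> m" "m \<le> l" "k \<le> l" "h \<in> carrier (G m)" for m l h
  proof (cases "k \<le> m")
    case True
    then show ?thesis
      using that n \<kappa>_\<iota>_le[of k m l h] \<kappa>_closed[of k m h] lim_in_\<iota>[of "m + 1" "l + 1" "\<kappa> m k h"] by simp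
  next
    case False
    then show ?thesis
      using that n \<kappa>_\<iota>_gt[of m k l h] lim_in_\<iota>[of m "l + 1" h] lim_in_\<iota>[of m "m + 1" h] by simp
  qed
  have "lim_in G \<iota> (m + 1) (?f m h) = lim_in G \<iota> (n + 1) (\<kappa> n k g)"
    if "(m, h) \<in> lim_in G \<iota> n g" for m h
  proof -
    have m: "1 \<le> m" "h \<in> carrier (G m)" "lim_in G \<iota> m h = lim_in G \<iota> n g"
      using that n g by (auto simp: in_lim_in_iff)
    then obtain l where l: "m \<le> l" "n \<le> l" "\<iota> m l h = \<iota> n l g"
      using n g by (auto simp: lim_in_eq_iff)
    show ?thesis
      using f[of m l h] f[of n l g] l m n g by simp
  qed
  moreover have "(n, g) \<in> lim_in G \<iota> n g"
    using n g by (simp add: in_lim_in_iff)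
  ultimately show ?thesis
    unfolding lim_\<kappa>_def by fast
qed

lemma \<rho>_permutes: "1 \<le> n \<Longrightarrow> g \<in> carrier (G n) \<Longrightarrow> \<rho> n g permutes {1..n}"
  using \<rho>_hom[of n] by (auto simp: hom_def sym_group_def Pi_iff)

lemma r_stage:
  assumes "1 \<le> n" "g \<in> stage n" "1 \<le> k" "k \<le> n"
  shows "1 \<le> r g k" "r g k \<le> n"
proof -
  obtain a where "a \<in> carrier (G n)" "g = lim_in G \<iota> n a"
    using assms(2) by (auto simp: stage_def)
  then have "r g k \<in> {1..n}"
    using assms permutes_in_image[OF \<rho>_permutes, of n a k] by (simp add: lim_\<rho>_lim_in)
  then show "1 \<le> r g k" "r g k \<le> n"
    by auto
qed

lemma K_stage: "1 \<le> k \<Longrightarrow> k \<le> n \<Longrightarrow> g \<in> stage n \<Longrightarrow> K k g \<in> stage (n + 1)"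
  using \<kappa>_closed by (auto simp: stage_def lim_\<kappa>_lim_in)

lemma r_inject:
  assumes "g \<in> carrier L" "r g i = r g j"
  shows "i = j"
proof -
  obtain n a where "1 \<le> n" "1 \<le> n" "a \<in> carrier (G n)" "g = lim_in G \<iota> n a"
    using lim_rep1[OF assms(1), of 1] .
  then show ?thesis
    using assms(2) permutes_inj[OF \<rho>_permutes, of n a] by (simp add: lim_\<rho>_lim_in inj_eq)
qed

lemma r_pos:
  assumes "g \<in> carrier L" "1 \<le> k"
  shows "1 \<le> r g k"
proof -
  obtain n a where "1 \<le> n" "k \<le> n" "a \<in> carrier (G n)" "g = lim_in G \<iota> n a"
    using lim_rep1[OF assms(1)] .
  then show ?thesis
    using r_stage[of n g k] assms(2) by (auto simp: stage_def)
qed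

lemma r_mult:
  assumes "g \<in> carrier L" "h \<in> carrier L"
  shows "r (g \<otimes>\<^bsub>L\<^esub> h) k = r g (r h k)"
proof -
  obtain n a b where *: "1 \<le> n" "1 \<le> n" "a \<in> carrier (G n)" "b \<in> carrier (G n)"
    "g = lim_in G \<iota> n a" "h = lim_in G \<iota> n b"
    using lim_rep2[OF assms, of 1] .
  then have "a \<otimes>\<^bsub>G n\<^esub> b \<in> carrier (G n)"
    using group.is_monoid[OF group_G] by (auto intro: monoid.m_closed)
  then show ?thesis
    using * hom_mult[OF \<rho>_hom, of n a b] by (simp add: lim_mult lim_\<rho>_lim_in sym_group_def)
qed

lemma r_one: "r \<one>\<^bsub>L\<^esub> k = k"
  using r_inject[of "\<one>\<^bsub>L\<^esub>" "r \<one>\<^bsub>L\<^esub> k" k] r_mult[of "\<one>\<^bsub>L\<^esub>" "\<one>\<^bsub>L\<^esub>" k] group_lim_group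
  by (simp add: group.is_monoid monoid.one_closed monoid.l_one)

lemma K_closed:
  assumes "g \<in> carrier L" "1 \<le> k"
  shows "K k g \<in> carrier L"
proof -
  obtain n a where *: "1 \<le> n" "k \<le> n" "a \<in> carrier (G n)" "g = lim_in G \<iota> n a"
    using lim_rep1[OF assms(1)] .
  then show ?thesis
    using assms(2) \<kappa>_closed[of k n a] lim_in_closed[of "n + 1" "\<kappa> n k a"] by (simp add: lim_\<kappa>_lim_in)
qed

lemma K_mult:
  assumes "g \<in> carrier L" "h \<in> carrier L" "1 \<le> k"
  shows "K k (g \<otimes>\<^bsub>L\<^esub> h) = K (r h k) g \<otimes>\<^bsub>L\<^esub> K k h"
proof -
  obtain n a b where *: "1 \<le> n" "k \<le> n" "a \<in> carrier (G n)" "b \<in> carrier (G n)"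
    "g = lim_in G \<iota> n a" "h = lim_in G \<iota> n b"
    using lim_rep2[OF assms(1,2)] .
  \<comment> \<open>The twisted index stays within \<open>1..n\<close>, so the factor
    \<open>a\<close> can be cloned at the same stage.\<close>
  have "1 \<le> \<rho> n b k" "\<rho> n b k \<le> n"
    using r_stage[of n h k] * assms by (auto simp: stage_def lim_\<rho>_lim_in)
  moreover have "a \<otimes>\<^bsub>G n\<^esub> b \<in> carrier (G n)"
    using group.is_monoid[OF group_G] * by (auto intro: monoid.m_closed)
  ultimately show ?thesis
    using * assms \<kappa>_closed[of _ n] \<kappa>_mult[of k n a b]
    by (simp add: lim_mult lim_\<kappa>_lim_in lim_\<rho>_lim_in del: One_nat_def)
qed

lemma K_one:
  assumes "1 \<le> k"
  shows "K k \<one>\<^bsub>L\<^esub> = \<one>\<^bsub>L\<^esub>"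
proof -
  interpret L: group L by (rule group_lim_group)
  have "K k \<one>\<^bsub>L\<^esub> = K k \<one>\<^bsub>L\<^esub> \<otimes>\<^bsub>L\<^esub> K k \<one>\<^bsub>L\<^esub>"
    using K_mult[of "\<one>\<^bsub>L\<^esub>" "\<one>\<^bsub>L\<^esub>" k] assms by (simp add: r_one)
  then show ?thesis
    using K_closed[of "\<one>\<^bsub>L\<^esub>" k] assms by simp
qed

lemma K_K:
  assumes "g \<in> carrier L" "1 \<le> k" "k < l"
  shows "K k (K l g) = K (l + 1) (K k g)"
proof -
  obtain n a where *: "1 \<le> n" "l \<le> n" "a \<in> carrier (G n)" "g = lim_in G \<iota> n a"
    using lim_rep1[OF assms(1)] .
  then show ?thesis
    using assms \<kappa>_closed[of k n a] \<kappa>_closed[of l n a] \<kappa>_\<kappa>[of k l n a] by (simp add: lim_\<kappa>_lim_in)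
qed

lemma K_inject:
  assumes "g \<in> carrier L" "h \<in> carrier L" "1 \<le> k" "K k g = K k h"
  shows "g = h"
proof -
  obtain n a b where *: "1 \<le> n" "k \<le> n" "a \<in> carrier (G n)" "b \<in> carrier (G n)"
    "g = lim_in G \<iota> n a" "h = lim_in G \<iota> n b"
    using lim_rep2[OF assms(1,2)] .
  then have "\<kappa> n k a = \<kappa> n k b"
    using assms(3,4) \<kappa>_closed by (intro lim_in_inject[of "n + 1"]) (simp_all add: lim_\<kappa>_lim_in)
  then show ?thesis
    using inj_onD[OF \<kappa>_inj[of k n]] * assms by auto
qed

lemma r_K:
  assumes "g \<in> carrier L" "1 \<le> k" "1 \<le> i" "i \<noteq> k" "i \<noteq> k + 1"
  shows "r (K k g) i = perm_clone k (r g) i"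
proof -
  obtain n a where *: "1 \<le> n" "k \<le> n" "a \<in> carrier (G n)" "g = lim_in G \<iota> n a"
    using lim_rep1[OF assms(1)] .
  then show ?thesis
    using assms \<kappa>_closed[of k n a] \<rho>_\<kappa>[of k n a i] by (simp add: lim_\<kappa>_lim_in lim_\<rho>_lim_in)
qed

text \<open>These are the values of cloned permutations needed for the caret relation. Both
  arguments avoid the two points that \<open>r_K\<close> excludes.\<close>

lemma r_K_less:
  assumes "g \<in> carrier L" "1 \<le> k" "k < l"
  shows "r (K l g) k = (if r g k < r g l then r g k else r g k + 1)"
    and "r (K k g) (l + 1) = (if r g l < r g k then r g l else r g l + 1)"
  using assms r_K[of g l k] r_K[of g k "l + 1"] r_inject[of g k l] by (auto simp: perm_clone_def)

end


section \<open>The action of the direct limit on forests\<close>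

context cloning_system
begin

sublocale L: group L
  by (rule group_lim_group)

text \<open>These two functions push a group element through a word in the carets by means of
  \<open>g \<lambda>\<^sub>k = \<lambda>\<^bsub>\<rho>(g)k\<^esub> (g)\<kappa>\<^sub>k\<close>: \<open>g w = (word_act g w) (word_exp g w)\<close>.\<close>

primrec word_act :: "(nat \<times> 'a) set \<Rightarrow> nat list \<Rightarrow> nat list" where
  "word_act g [] = []"
| "word_act g (k # w) = r g k # word_act (K k g) w"

primrec word_exp :: "(nat \<times> 'a) set \<Rightarrow> nat list \<Rightarrow> (nat \<times> 'a) set" where
  "word_exp g [] = g"
| "word_exp g (k # w) = word_exp (K k g) w"

lemma length_word_act: "length (word_act g w) = length w"
  by (induction w arbitrary: g) auto

lemma word_exp_closed: "g \<in> carrier L \<Longrightarrow> pos_word w \<Longrightarrow> word_exp g w \<in> carrier L"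
  by (induction w arbitrary: g) (auto simp: K_closed)

lemma word_act_pos: "g \<in> carrier L \<Longrightarrow> pos_word w \<Longrightarrow> pos_word (word_act g w)"
proof (induction w arbitrary: g)
  case (Cons k w)
  then show ?case
    using r_pos[of g k] K_closed[of g k] by auto
qed simp

text \<open>An element of stage \<open>n\<close> permutes the \<open>n\<close> feet, and cloning
  raises the stage by one exactly when the caret adds a foot.\<close>

lemma word_act_valid:
  assumes "1 \<le> n" "g \<in> stage n" "valid n w"
  shows "valid n (word_act g w)" and "word_exp g w \<in> stage (n + length w)"
proof -
  have "valid n (word_act g w) \<and> word_exp g w \<in> stage (n + length w)"
    using assms
  proof (induction w arbitrary: n g)
    case (Cons k w)
    then show ?case
      using r_stage[of n g k] K_stage[of k n g] Cons.IH[of "n + 1" "K k g"] by simp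
  qed simp
  then show "valid n (word_act g w)" "word_exp g w \<in> stage (n + length w)"
    by auto
qed

text \<open>The action law, with \<open>word_exp\<close> as its cocycle; it iterates
  \<open>r_mult\<close> and \<open>K_mult\<close>.\<close>

lemma word_act_mult:
  "g \<in> carrier L \<Longrightarrow> h \<in> carrier L \<Longrightarrow> pos_word w
    \<Longrightarrow> word_act (g \<otimes>\<^bsub>L\<^esub> h) w = word_act g (word_act h w)
      \<and> word_exp (g \<otimes>\<^bsub>L\<^esub> h) w = word_exp g (word_act h w) \<otimes>\<^bsub>L\<^esub> word_exp h w"
proof (induction w arbitrary: g h)
  case (Cons k w)
  then show ?case
    using r_pos[of h k] Cons.IH[of "K (r h k) g" "K k h"]
    by (simp add: r_mult K_mult K_closed)
qed simp

lemma word_act_one: "pos_word w \<Longrightarrow> word_act \<one>\<^bsub>L\<^esub> w = w \<and> word_exp \<one>\<^bsub>L\<^esub> w = \<one>\<^bsub>L\<^esub>"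
  by (induction w) (auto simp: r_one K_one)

lemma word_exp_inject:
  "g \<in> carrier L \<Longrightarrow> h \<in> carrier L \<Longrightarrow> pos_word w \<Longrightarrow> word_exp g w = word_exp h w \<Longrightarrow> g = h"
proof (induction w arbitrary: g h)
  case (Cons k w)
  then show ?case
    using Cons.IH[of "K k g" "K k h"] K_inject[of g h k] by (simp add: K_closed)
qed simp

section \<open>Passage from caret words to forests\<close>

text \<open>Images are compared as forests, since words that differ by a caret relation go to words
  that differ by another one. Equality of lengths keeps the induction in \<open>same_actionI\<close>
  running.\<close>

definition same_action :: "nat list \<Rightarrow> nat list \<Rightarrow> bool" where
  "same_action u v \<longleftrightarrow> length u = length v \<and> (\<forall>g\<in>carrier L.
     forest_of (word_act g u) = forest_of (word_act g v) \<and> word_exp g u = word_exp g v)"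

lemma same_action_Cons: "1 \<le> k \<Longrightarrow> same_action u v \<Longrightarrow> same_action (k # u) (k # v)"
  by (auto simp: same_action_def K_closed)

lemma same_action_sym: "same_action u v \<Longrightarrow> same_action v u"
  by (auto simp: same_action_def)

lemma same_action_trans: "same_action u v \<Longrightarrow> same_action v w \<Longrightarrow> same_action u w"
  by (auto simp: same_action_def)

text \<open>By \<open>r_K_less\<close> the two image words again start with the two sides of a caret
  relation. Which side is which depends on whether \<open>g\<close> preserves or reverses the order
  of \<open>k\<close> and \<open>l\<close>.\<close>

lemma same_action_swap:
  assumes "1 \<le> k" "k < l"
  shows "same_action (k # (l + 1) # w) (l # k # w)"
proof -
  have "forest_of (word_act g (k # (l + 1) # w)) = forest_of (word_act g (l # k # w))"
    "word_exp g (k # (l + 1) # w) = word_exp g (l # k # w)" if g: "g \<in> carrier L" for g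
  proof -
    have "r g k \<noteq> r g l"
      using r_inject[OF g, of k l] assms by auto
    then consider "r g k < r g l" | "r g l < r g k"
      by linarith
    then show "forest_of (word_act g (k # (l + 1) # w)) = forest_of (word_act g (l # k # w))"
      using r_K_less[OF g assms] K_K[OF g assms] merge_merge[of "r g k" "r g l"] merge_merge[of "r g l" "r g k"]
      by cases auto
    show "word_exp g (k # (l + 1) # w) = word_exp g (l # k # w)"
      using K_K[OF g assms] by simp
  qed
  then show ?thesis
    by (simp add: same_action_def)
qed

text \<open>This amounts to saying that the relations \<open>\<lambda>\<^sub>j \<lambda>\<^sub>i = \<lambda>\<^sub>i \<lambda>\<^bsub>j+1\<^esub>\<close> present the
  forest monoid: if \<open>\<lambda>\<^sub>k E = \<lambda>\<^sub>l E'\<close> with \<open>k < l\<close>, then both are multiples of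
  \<open>\<lambda>\<^sub>k \<lambda>\<^bsub>l+1\<^esub> = \<lambda>\<^sub>l \<lambda>\<^sub>k\<close>.\<close>

lemma same_actionI:
  "pos_word u \<Longrightarrow> pos_word v \<Longrightarrow> forest_of u = forest_of v \<Longrightarrow> same_action u v"
proof (induction "length u" arbitrary: u v rule: less_induct)
  case less
  show ?case
  proof (cases u)
    case Nil
    then have "v = []"
      using less.prems merge_not_empty by (cases v) (auto simp: eq_commute)
    then show ?thesis
      using Nil by (simp add: same_action_def)
  next
    case (Cons k u')
    then obtain l v' where v: "v = l # v'"
      using less.prems merge_not_empty by (cases v) auto
    have kl: "1 \<le> k" "1 \<le> l" "pos_word u'" "pos_word v'"
      and eq: "merge k (forest_of u') = merge l (forest_of v')"
      using less.prems Cons v by auto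
    show ?thesis
    proof (cases "k = l")
      case True
      then have "same_action u' v'"
        using less.hyps[of u' v'] kl eq merge_inject[of k "forest_of u'"] Cons by simp
      then show ?thesis
        using same_action_Cons kl(1) True Cons v by simp
    next
      case False
      \<comment> \<open>The word \<open>w\<close> spells what remains after both carets are removed.
        It links \<open>u\<close> to \<open>k # a # w\<close> and \<open>v\<close> to
        \<open>l # b # w\<close>, which differ by one swap.\<close>
      obtain a b w where *: "1 \<le> a" "1 \<le> b" "pos_word w" "forest_of u' = forest_of (a # w)"
        "forest_of v' = forest_of (b # w)" "same_action (k # a # w) (l # b # w)"
      proof (cases "k < l")
        case True
        obtain E where "forest_of u' = merge (l + 1) E" "forest_of v' = merge k E"
          "E \<in> carrier forest_monoid"
          using merge_eq_mergeD[OF eq kl(1) True forest_of_closed[OF kl(3)]] .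
        moreover from this(3) obtain w where "pos_word w" "forest_of w = E"
          by (rule forest_of_surj)
        ultimately show ?thesis
          using that[of "l + 1" k w] kl True same_action_swap by simp
      next
        case False
        with \<open>k \<noteq> l\<close> have "l < k" by simp
        obtain E where "forest_of v' = merge (k + 1) E" "forest_of u' = merge l E"
          "E \<in> carrier forest_monoid"
          using merge_eq_mergeD[OF eq[symmetric] kl(2) \<open>l < k\<close> forest_of_closed[OF kl(4)]] .
        moreover from this(3) obtain w where "pos_word w" "forest_of w = E"
          by (rule forest_of_surj)
        ultimately show ?thesis
          using that[of l "k + 1" w] kl \<open>l < k\<close> same_action_swap[THEN same_action_sym] by simp
      qed
      have 1: "same_action u' (a # w)"
        using less.hyps[of u' "a # w"] Cons kl * by auto
      \<comment> \<open>The words \<open>a # w\<close> and \<open>b # w\<close> are equally long, so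
        the induction hypothesis also covers \<open>b # w\<close>.\<close>
      then have "length (b # w) = length u'"
        by (simp add: same_action_def)
      then have "same_action (b # w) v'"
        using less.hyps[of "b # w" v'] Cons kl * by auto
      then show ?thesis
        using 1 * kl unfolding Cons v by (meson same_action_Cons same_action_trans)
    qed
  qed
qed

definition act :: "(nat \<times> 'a) set \<Rightarrow> forest \<Rightarrow> forest" where
  "act g E = forest_of (word_act g (SOME w. pos_word w \<and> forest_of w = E))"

definition exp :: "(nat \<times> 'a) set \<Rightarrow> forest \<Rightarrow> (nat \<times> 'a) set" where
  "exp g E = word_exp g (SOME w. pos_word w \<and> forest_of w = E)"

text \<open>By \<open>same_actionI\<close> the word chosen in the definitions may be replaced by any
  other word for the same forest.\<close>

lemma act_forest_of:
  assumes "g \<in> carrier L" "pos_word w"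
  shows "act g (forest_of w) = forest_of (word_act g w)" and "exp g (forest_of w) = word_exp g w"
proof -
  define v where "v = (SOME v. pos_word v \<and> forest_of v = forest_of w)"
  have "pos_word v \<and> forest_of v = forest_of w"
    unfolding v_def by (rule someI[of _ w]) (simp add: assms)
  then have "same_action v w"
    using assms by (auto intro: same_actionI)
  then show "act g (forest_of w) = forest_of (word_act g w)" "exp g (forest_of w) = word_exp g w"
    using assms by (auto simp: act_def exp_def v_def same_action_def)
qed


section \<open>The normal form\<close>

text \<open>A pair \<open>(E, h)\<close> stands for the product of \<open>E\<close> and
  \<open>h\<close>, and a letter acts by left multiplication followed by rewriting to this
  shape.\<close>

definition letter_act :: "'a letter \<Rightarrow> forest \<times> (nat \<times> 'a) set \<Rightarrow> forest \<times> (nat \<times> 'a) set" where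
  "letter_act x p = (case x of Inl E \<Rightarrow> (forest_mult E (fst p), snd p)
     | Inr g \<Rightarrow> (act g (fst p), exp g (fst p) \<otimes>\<^bsub>L\<^esub> snd p))"

abbreviation A :: "'a letter set" where "A \<equiv> fg_letters G \<iota>"
abbreviation R :: "('a letter list \<times> 'a letter list) set" where "R \<equiv> fg_relations G \<iota> \<rho> \<kappa>"
abbreviation M :: "'a letter list set monoid" where "M \<equiv> fg_monoid G \<iota> \<rho> \<kappa>"

lemma Inl_letter [simp]: "Inl E \<in> A \<longleftrightarrow> E \<in> carrier forest_monoid"
  and Inr_letter [simp]: "Inr g \<in> A \<longleftrightarrow> g \<in> carrier L"
  by (auto simp: fg_letters_def)

lemma forest_mult_closed:
  "E \<in> carrier forest_monoid \<Longrightarrow> F \<in> carrier forest_monoid \<Longrightarrow> forest_mult E F \<in> carrier forest_monoid"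
  using monoid.m_closed[OF monoid_forest_monoid] by (simp add: forest_mult_eq)

lemma forest_mult_assoc:
  "E \<in> carrier forest_monoid \<Longrightarrow> F \<in> carrier forest_monoid \<Longrightarrow> H \<in> carrier forest_monoid
    \<Longrightarrow> forest_mult (forest_mult E F) H = forest_mult E (forest_mult F H)"
  using monoid.m_assoc[OF monoid_forest_monoid] by (simp add: forest_mult_eq)

lemma act_closed:
  assumes "g \<in> carrier L" "E \<in> carrier forest_monoid"
  shows "act g E \<in> carrier forest_monoid" and "exp g E \<in> carrier L"
proof -
  obtain w where "pos_word w" "forest_of w = E"
    using assms(2) by (rule forest_of_surj)
  then show "act g E \<in> carrier forest_monoid" "exp g E \<in> carrier L"
    using assms(1) act_forest_of[of g w] word_act_pos[of g w] word_exp_closed[of g w]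
    by (auto simp: forest_of_closed)
qed

lemma letter_act_closed:
  "x \<in> A \<Longrightarrow> p \<in> carrier forest_monoid \<times> carrier L \<Longrightarrow> letter_act x p \<in> carrier forest_monoid \<times> carrier L"
  by (auto simp: letter_act_def fg_letters_def forest_mult_closed act_closed)

lemma foldr_letter_act_closed:
  "w \<in> lists A \<Longrightarrow> p \<in> carrier forest_monoid \<times> carrier L
    \<Longrightarrow> foldr letter_act w p \<in> carrier forest_monoid \<times> carrier L"
proof (induction w)
  case (Cons x w)
  then have "foldr letter_act w p \<in> carrier forest_monoid \<times> carrier L" "x \<in> A" by auto
  then show ?case
    using letter_act_closed by simp
qed simp

text \<open>This lets the action descend from words to \<open>M\<close>. Products of group letters
  are covered by \<open>word_act_mult\<close>, and the mixed relation is the recursion defining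
  \<open>word_act\<close> and \<open>word_exp\<close>.\<close>

lemma letter_act_relation:
  assumes "(u, v) \<in> R" "p \<in> carrier forest_monoid \<times> carrier L"
  shows "foldr letter_act u p = foldr letter_act v p"
proof -
  obtain F h where p: "p = (F, h)" "F \<in> carrier forest_monoid" "h \<in> carrier L"
    using assms(2) by auto
  obtain w where w: "pos_word w" "forest_of w = F"
    using p(2) by (rule forest_of_surj)
  have F0: "F 0 = Leaf"
    using p by (simp add: forest_carrier)
  consider "u = [Inl empty_forest]" "v = []"
    | E E' where "E \<in> carrier forest_monoid" "E' \<in> carrier forest_monoid" "u = [Inl E, Inl E']" "v = [Inl (forest_mult E E')]"
    | "u = [Inr \<one>\<^bsub>L\<^esub>]" "v = []"
    | g g' where "g \<in> carrier L" "g' \<in> carrier L" "u = [Inr g, Inr g']" "v = [Inr (g \<otimes>\<^bsub>L\<^esub> g')]"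
    | g k where "g \<in> carrier L" "1 \<le> k" "u = [Inr g, Inl (caret k)]" "v = [Inl (caret (r g k)), Inr (K k g)]"
    using assms(1)
    unfolding fg_relations_def forest_one forest_mult_eq Un_iff mem_Collect_eq singleton_iff prod.inject
    by (elim disjE exE conjE) blast+
  then show ?thesis
  proof cases
    case 1
    then show ?thesis
      using p F0 by (simp add: letter_act_def forest_mult_empty_left)
  next
    case 2
    then show ?thesis
      using p by (simp add: letter_act_def forest_mult_assoc)
  next
    case 3
    then show ?thesis
      using p w act_forest_of[of "\<one>\<^bsub>L\<^esub>" w] by (auto simp: letter_act_def word_act_one)
  next
    case 4
    have "pos_word (word_act g' w)"
      using 4 w word_act_pos by auto
    then show ?thesis
      using p w 4 act_forest_of[of g' w] act_forest_of[of g "word_act g' w"]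
        act_forest_of[of "g \<otimes>\<^bsub>L\<^esub> g'" w] word_act_mult[of g g' w]
      by (auto simp: letter_act_def L.m_assoc word_exp_closed)
  next
    case 5
    have "merge k F = forest_of (k # w)" "pos_word (k # w)"
      using w 5 by auto
    moreover have "1 \<le> r g k" "K k g \<in> carrier L"
      using 5 r_pos K_closed by auto
    moreover from this have "act (K k g) F \<in> carrier forest_monoid"
      using p act_closed by auto
    ultimately show ?thesis
      using p w 5 F0 act_forest_of[of g "k # w"] act_forest_of[of "K k g" w]
      by (auto simp: letter_act_def caret_forest_mult forest_carrier)
  qed
qed

lemma letter_act_cong:
  "(u, v) \<in> word_cong A R \<Longrightarrow> p \<in> carrier forest_monoid \<times> carrier L
    \<Longrightarrow> foldr letter_act u p = foldr letter_act v p"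
proof (induction arbitrary: p rule: word_cong.induct)
  case (rel u v p' q)
  then have "foldr letter_act q p \<in> carrier forest_monoid \<times> carrier L"
    by (intro foldr_letter_act_closed)
  then show ?case
    using letter_act_relation[OF rel.hyps(1)] by simp
qed auto

section \<open>Forests and group elements inside the monoid\<close>

definition of_forest :: "forest \<Rightarrow> 'a letter list set" where
  "of_forest E = word_class A R [Inl E]"

definition of_group :: "(nat \<times> 'a) set \<Rightarrow> 'a letter list set" where
  "of_group g = word_class A R [Inr g]"

sublocale M: monoid M
  unfolding fg_monoid_def by (rule monoid_presented_monoid)

lemma word_class_mult:
  "u \<in> lists A \<Longrightarrow> v \<in> lists A \<Longrightarrow> word_class A R u \<otimes>\<^bsub>M\<^esub> word_class A R v = word_class A R (u @ v)"
  unfolding fg_monoid_def by (rule mult_presented_monoid)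

lemma carrier_M: "carrier M = word_class A R ` lists A"
  by (simp add: fg_monoid_def carrier_presented_monoid)

lemma of_forest_closed [simp]: "E \<in> carrier forest_monoid \<Longrightarrow> of_forest E \<in> carrier M"
  by (auto simp: carrier_M of_forest_def)

lemma of_group_closed [simp]: "g \<in> carrier L \<Longrightarrow> of_group g \<in> carrier M"
  by (auto simp: carrier_M of_group_def)

lemma of_forest_one: "of_forest empty_forest = \<one>\<^bsub>M\<^esub>"
proof -
  have "([Inl empty_forest], []) \<in> R"
    by (simp add: fg_relations_def forest_one)
  then show ?thesis
    unfolding of_forest_def fg_monoid_def one_presented_monoid
    by (rule word_class_relI) (auto simp: empty_forest_closed)
qed

lemma of_group_one: "of_group \<one>\<^bsub>L\<^esub> = \<one>\<^bsub>M\<^esub>"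
proof -
  have "([Inr \<one>\<^bsub>L\<^esub>], []) \<in> R"
    by (simp add: fg_relations_def)
  then show ?thesis
    unfolding of_group_def fg_monoid_def one_presented_monoid
    by (rule word_class_relI) auto
qed

lemma of_forest_mult:
  assumes "E \<in> carrier forest_monoid" "F \<in> carrier forest_monoid"
  shows "of_forest (forest_mult E F) = of_forest E \<otimes>\<^bsub>M\<^esub> of_forest F"
proof -
  have "([Inl E, Inl F], [Inl (forest_mult E F)]) \<in> R"
    using assms by (simp add: fg_relations_def forest_mult_eq)
  then have "word_class A R [Inl E, Inl F] = word_class A R [Inl (forest_mult E F)]"
    by (rule word_class_relI) (use assms in \<open>auto simp: forest_mult_closed\<close>)
  then show ?thesis
    using assms by (simp add: of_forest_def word_class_mult)
qed

lemma of_group_mult: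
  assumes "g \<in> carrier L" "h \<in> carrier L"
  shows "of_group (g \<otimes>\<^bsub>L\<^esub> h) = of_group g \<otimes>\<^bsub>M\<^esub> of_group h"
proof -
  have "([Inr g, Inr h], [Inr (g \<otimes>\<^bsub>L\<^esub> h)]) \<in> R"
    using assms by (simp add: fg_relations_def)
  then have "word_class A R [Inr g, Inr h] = word_class A R [Inr (g \<otimes>\<^bsub>L\<^esub> h)]"
    by (rule word_class_relI) (use assms in auto)
  then show ?thesis
    using assms by (simp add: of_group_def word_class_mult)
qed

lemma of_group_caret:
  assumes "g \<in> carrier L" "1 \<le> k"
  shows "of_group g \<otimes>\<^bsub>M\<^esub> of_forest (caret k) = of_forest (caret (r g k)) \<otimes>\<^bsub>M\<^esub> of_group (K k g)"
proof -
  have "([Inr g, Inl (caret k)], [Inl (caret (r g k)), Inr (K k g)]) \<in> R"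
    using assms unfolding fg_relations_def by blast
  then have "word_class A R [Inr g, Inl (caret k)] = word_class A R [Inl (caret (r g k)), Inr (K k g)]"
    by (rule word_class_relI) (use assms r_pos in \<open>auto simp: caret_closed K_closed\<close>)
  then show ?thesis
    using assms r_pos[OF assms] by (simp add: of_group_def of_forest_def word_class_mult caret_closed K_closed)
qed

lemma of_group_of_word:
  "g \<in> carrier L \<Longrightarrow> pos_word w \<Longrightarrow> of_group g \<otimes>\<^bsub>M\<^esub> of_forest (forest_of w)
    = of_forest (forest_of (word_act g w)) \<otimes>\<^bsub>M\<^esub> of_group (word_exp g w)"
proof (induction w arbitrary: g)
  case Nil
  then show ?case
    by (simp add: of_forest_one)
next
  case (Cons k w)
  have C: "1 \<le> k" "1 \<le> r g k" "K k g \<in> carrier L" "pos_word w" "pos_word (word_act (K k g) w)"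
    using Cons.prems r_pos K_closed word_act_pos by auto
  have split: "of_forest (forest_of (l # v)) = of_forest (caret l) \<otimes>\<^bsub>M\<^esub> of_forest (forest_of v)"
    if "1 \<le> l" "pos_word v" for l v
    using that of_forest_mult[OF caret_closed forest_of_closed, of l v] forest_of_closed[of v]
    by (simp add: caret_forest_mult forest_carrier)
  note cl = of_forest_closed[OF forest_of_closed] of_forest_closed[OF caret_closed] of_group_closed
  have "of_group g \<otimes>\<^bsub>M\<^esub> of_forest (forest_of (k # w))
      = (of_group g \<otimes>\<^bsub>M\<^esub> of_forest (caret k)) \<otimes>\<^bsub>M\<^esub> of_forest (forest_of w)"
    unfolding split[OF C(1,4)] using C Cons.prems cl by (intro M.m_assoc[symmetric]) auto
  also have "\<dots> = of_forest (caret (r g k)) \<otimes>\<^bsub>M\<^esub> (of_group (K k g) \<otimes>\<^bsub>M\<^esub> of_forest (forest_of w))"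
    unfolding of_group_caret[OF Cons.prems(1) C(1)] using C cl by (intro M.m_assoc) auto
  also have "\<dots> = of_forest (caret (r g k)) \<otimes>\<^bsub>M\<^esub> of_forest (forest_of (word_act (K k g) w))
      \<otimes>\<^bsub>M\<^esub> of_group (word_exp (K k g) w)"
    unfolding Cons.IH[OF C(3,4)] using C cl word_exp_closed by (intro M.m_assoc[symmetric]) auto
  also have "\<dots> = of_forest (forest_of (r g k # word_act (K k g) w)) \<otimes>\<^bsub>M\<^esub> of_group (word_exp (K k g) w)"
    unfolding split[OF C(2,5)] ..
  finally show ?case
    by simp
qed

lemma of_group_of_forest:
  assumes "g \<in> carrier L" "E \<in> carrier forest_monoid"
  shows "of_group g \<otimes>\<^bsub>M\<^esub> of_forest E = of_forest (act g E) \<otimes>\<^bsub>M\<^esub> of_group (exp g E)"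
proof -
  obtain w where "pos_word w" "forest_of w = E"
    using assms(2) by (rule forest_of_surj)
  then show ?thesis
    using of_group_of_word[of g w] act_forest_of[of g w] assms(1) by simp
qed

text \<open>Letters are absorbed from the right end of the word. A new forest letter multiplies the
  forest part, and a new group letter is first moved across it by
  \<open>of_group_of_forest\<close>.\<close>

lemma normal_form:
  assumes "x \<in> carrier M"
  obtains E g where "E \<in> carrier forest_monoid" "g \<in> carrier L" "x = of_forest E \<otimes>\<^bsub>M\<^esub> of_group g"
proof -
  have "\<exists>E\<in>carrier forest_monoid. \<exists>g\<in>carrier L. word_class A R w = of_forest E \<otimes>\<^bsub>M\<^esub> of_group g"
    if "w \<in> lists A" for w
    using that
  proof (induction w)
    case Nil
    have "word_class A R [] = of_forest empty_forest \<otimes>\<^bsub>M\<^esub> of_group \<one>\<^bsub>L\<^esub>"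
      by (simp add: of_forest_one of_group_one) (simp add: fg_monoid_def one_presented_monoid)
    then show ?case
      using empty_forest_closed L.one_closed by blast
  next
    case (Cons x w)
    then obtain E g where E: "E \<in> carrier forest_monoid" and g: "g \<in> carrier L"
      and w: "word_class A R w = of_forest E \<otimes>\<^bsub>M\<^esub> of_group g"
      by auto
    have xw: "word_class A R (x # w) = word_class A R [x] \<otimes>\<^bsub>M\<^esub> (of_forest E \<otimes>\<^bsub>M\<^esub> of_group g)"
      using Cons.hyps word_class_mult[of "[x]" w] by (simp add: w)
    show ?case
    proof (cases x)
      case (Inl F)
      then have F: "F \<in> carrier forest_monoid"
        using Cons.hyps by simp
      have "word_class A R (x # w) = of_forest (forest_mult F E) \<otimes>\<^bsub>M\<^esub> of_group g"
        unfolding xw using Inl F E g by (simp add: of_forest_mult M.m_assoc flip: of_forest_def)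
      then show ?thesis
        using F E g forest_mult_closed by blast
    next
      case (Inr h)
      then have h: "h \<in> carrier L"
        using Cons.hyps by simp
      have "word_class A R (x # w) = (of_group h \<otimes>\<^bsub>M\<^esub> of_forest E) \<otimes>\<^bsub>M\<^esub> of_group g"
        unfolding xw using Inr h E g by (simp add: M.m_assoc flip: of_group_def)
      also have "\<dots> = of_forest (act h E) \<otimes>\<^bsub>M\<^esub> of_group (exp h E \<otimes>\<^bsub>L\<^esub> g)"
        unfolding of_group_of_forest[OF h E] using h E g
        by (simp add: M.m_assoc of_group_mult act_closed)
      finally show ?thesis
        using h E g act_closed by blast
    qed
  qed
  then show ?thesis
    using assms that by (auto simp: carrier_M)
qed

lemma normal_form_unique:
  assumes "E \<in> carrier forest_monoid" "g \<in> carrier L" "E' \<in> carrier forest_monoid" "g' \<in> carrier L"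
    and eq: "of_forest E \<otimes>\<^bsub>M\<^esub> of_group g = of_forest E' \<otimes>\<^bsub>M\<^esub> of_group g'"
  shows "E = E'" and "g = g'"
proof -
  \<comment> \<open>The trivial forest is spelled by the empty word, through which \<open>h\<close>
    passes unchanged; so the action on the trivial pair reads off the normal form.\<close>
  have *: "foldr letter_act [Inl F, Inr h] (empty_forest, \<one>\<^bsub>L\<^esub>) = (F, h)"
    if "F \<in> carrier forest_monoid" "h \<in> carrier L" for F h
    using that act_forest_of[of h "[]"]
    by (simp add: letter_act_def forest_mult_empty_right forest_carrier)
  have "word_class A R [Inl E, Inr g] = word_class A R [Inl E', Inr g']"
    using eq assms by (simp add: of_forest_def of_group_def word_class_mult)
  then have "([Inl E, Inr g], [Inl E', Inr g']) \<in> word_cong A R"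
    using assms by (subst (asm) word_class_eq_iff) auto
  then have "foldr letter_act [Inl E, Inr g] (empty_forest, \<one>\<^bsub>L\<^esub>)
      = foldr letter_act [Inl E', Inr g'] (empty_forest, \<one>\<^bsub>L\<^esub>)"
    by (rule letter_act_cong) (simp add: empty_forest_closed)
  then show "E = E'" "g = g'"
    unfolding *[OF assms(1,2)] *[OF assms(3,4)] by auto
qed

section \<open>Cancellation and common multiples in the monoid\<close>

lemma of_group_inv:
  assumes "g \<in> carrier L" "x \<in> carrier M"
  shows "of_group (inv\<^bsub>L\<^esub> g) \<otimes>\<^bsub>M\<^esub> (of_group g \<otimes>\<^bsub>M\<^esub> x) = x"
    and "of_group g \<otimes>\<^bsub>M\<^esub> (of_group (inv\<^bsub>L\<^esub> g) \<otimes>\<^bsub>M\<^esub> x) = x"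
proof -
  have "of_group (inv\<^bsub>L\<^esub> g) \<otimes>\<^bsub>M\<^esub> of_group g = \<one>\<^bsub>M\<^esub>" "of_group g \<otimes>\<^bsub>M\<^esub> of_group (inv\<^bsub>L\<^esub> g) = \<one>\<^bsub>M\<^esub>"
    using assms(1) of_group_mult[of "inv\<^bsub>L\<^esub> g" g] of_group_mult[of g "inv\<^bsub>L\<^esub> g"]
    by (simp_all add: of_group_one)
  then show "of_group (inv\<^bsub>L\<^esub> g) \<otimes>\<^bsub>M\<^esub> (of_group g \<otimes>\<^bsub>M\<^esub> x) = x"
    "of_group g \<otimes>\<^bsub>M\<^esub> (of_group (inv\<^bsub>L\<^esub> g) \<otimes>\<^bsub>M\<^esub> x) = x"
    using assms by (simp_all flip: M.m_assoc)
qed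

text \<open>Left multiplication by a forest alters only the forest part of a normal form, so
  uniqueness reduces the claim to cancellation of forests.\<close>

lemma of_forest_cancel:
  assumes E: "E \<in> carrier forest_monoid" and x: "x \<in> carrier M" and y: "y \<in> carrier M"
    and eq: "of_forest E \<otimes>\<^bsub>M\<^esub> x = of_forest E \<otimes>\<^bsub>M\<^esub> y"
  shows "x = y"
proof -
  obtain F h where F: "F \<in> carrier forest_monoid" "h \<in> carrier L" "x = of_forest F \<otimes>\<^bsub>M\<^esub> of_group h"
    using x by (rule normal_form)
  obtain F' h' where F': "F' \<in> carrier forest_monoid" "h' \<in> carrier L" "y = of_forest F' \<otimes>\<^bsub>M\<^esub> of_group h'"
    using y by (rule normal_form)
  have "of_forest (forest_mult E F) \<otimes>\<^bsub>M\<^esub> of_group h = of_forest (forest_mult E F') \<otimes>\<^bsub>M\<^esub> of_group h'"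
    using eq E F F' by (simp add: of_forest_mult M.m_assoc)
  then have "forest_mult E F = forest_mult E F'" "h = h'"
    using normal_form_unique[of "forest_mult E F" h "forest_mult E F'" h'] E F F' forest_mult_closed by auto
  then show ?thesis
    using forest_l_cancel[of E F F'] E F F' by (auto simp: forest_carrier)
qed

lemma forest_common_multiple:
  assumes "E \<in> carrier forest_monoid" "F \<in> carrier forest_monoid"
  shows "\<exists>E'\<in>carrier forest_monoid. \<exists>F'\<in>carrier forest_monoid. forest_mult E E' = forest_mult F F'"
proof -
  obtain u where u: "pos_word u" "forest_of u = E" using assms(1) by (rule forest_of_surj)
  obtain v where v: "pos_word v" "forest_of v = F" using assms(2) by (rule forest_of_surj)
  \<comment> \<open>A large enough number of roots makes both words valid, as
    \<open>forest_of_common_multiple\<close> requires.\<close>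
  obtain m n where "valid m u" "valid n v"
    using u v pos_word_valid by blast
  then have "valid (max m n) u" "valid (max m n) v"
    by (auto intro: valid_mono)
  then obtain u' v' where "valid (max m n + length u) u'" "valid (max m n + length v) v'"
    "forest_of (u @ u') = forest_of (v @ v')"
    using forest_of_common_multiple by blast
  then show ?thesis
    using u v forest_of_append[of u u'] forest_of_append[of v v'] forest_of_closed valid_pos
    by metis
qed

text \<open>Group elements are invertible in \<open>M\<close>, so both conditions reduce to the
  forest parts of normal forms.\<close>

sublocale M: ore_monoid M
proof unfold_locales
  fix a b c
  assume C: "a \<in> carrier M" "b \<in> carrier M" "c \<in> carrier M" and eq: "a \<otimes>\<^bsub>M\<^esub> b = a \<otimes>\<^bsub>M\<^esub> c"
  obtain E g where E: "E \<in> carrier forest_monoid" "g \<in> carrier L" "a = of_forest E \<otimes>\<^bsub>M\<^esub> of_group g"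
    using C(1) by (rule normal_form)
  have "of_group g \<otimes>\<^bsub>M\<^esub> b = of_group g \<otimes>\<^bsub>M\<^esub> c"
    by (rule of_forest_cancel[OF E(1)]) (use eq E C in \<open>simp_all add: M.m_assoc\<close>)
  then show "b = c"
    using of_group_inv(1)[OF E(2) C(2)] of_group_inv(1)[OF E(2) C(3)] by metis
next
  fix a b
  assume C: "a \<in> carrier M" "b \<in> carrier M"
  obtain E g where E: "E \<in> carrier forest_monoid" "g \<in> carrier L" "a = of_forest E \<otimes>\<^bsub>M\<^esub> of_group g"
    using C(1) by (rule normal_form)
  obtain F h where F: "F \<in> carrier forest_monoid" "h \<in> carrier L" "b = of_forest F \<otimes>\<^bsub>M\<^esub> of_group h"
    using C(2) by (rule normal_form)
  obtain E' F' where EF: "E' \<in> carrier forest_monoid" "F' \<in> carrier forest_monoid"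
    "forest_mult E E' = forest_mult F F'"
    using forest_common_multiple[OF E(1) F(1)] by blast
  have "a \<otimes>\<^bsub>M\<^esub> (of_group (inv\<^bsub>L\<^esub> g) \<otimes>\<^bsub>M\<^esub> of_forest E') = of_forest (forest_mult E E')"
    using E EF(1,2) by (simp add: M.m_assoc of_group_inv of_forest_mult)
  moreover have "b \<otimes>\<^bsub>M\<^esub> (of_group (inv\<^bsub>L\<^esub> h) \<otimes>\<^bsub>M\<^esub> of_forest F') = of_forest (forest_mult F F')"
    using F EF(1,2) by (simp add: M.m_assoc of_group_inv of_forest_mult)
  ultimately show "\<exists>x\<in>carrier M. \<exists>y\<in>carrier M. a \<otimes>\<^bsub>M\<^esub> x = b \<otimes>\<^bsub>M\<^esub> y"
    using E F EF by (metis L.inv_closed M.m_closed of_forest_closed of_group_closed)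
qed

text \<open>Equal fractions only give equality after multiplication by some \<open>x\<close>.
  Comparing the group parts of the normal forms gives \<open>exp g E = exp h E\<close>, and iterated
  cloning is injective.\<close>

lemma of_group_frac_inject:
  assumes "g \<in> carrier L" "h \<in> carrier L" "frac_in M (of_group g) = frac_in M (of_group h)"
  shows "g = h"
proof -
  obtain x where x: "x \<in> carrier M" "of_group g \<otimes>\<^bsub>M\<^esub> x = of_group h \<otimes>\<^bsub>M\<^esub> x"
    using assms by (auto simp: M.frac_in_eq_iff)
  obtain E k where E: "E \<in> carrier forest_monoid" "k \<in> carrier L" "x = of_forest E \<otimes>\<^bsub>M\<^esub> of_group k"
    using x(1) by (rule normal_form)
  have *: "of_group f \<otimes>\<^bsub>M\<^esub> x = of_forest (act f E) \<otimes>\<^bsub>M\<^esub> of_group (exp f E \<otimes>\<^bsub>L\<^esub> k)" if "f \<in> carrier L" for f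
  proof -
    have "of_group f \<otimes>\<^bsub>M\<^esub> x = (of_group f \<otimes>\<^bsub>M\<^esub> of_forest E) \<otimes>\<^bsub>M\<^esub> of_group k"
      using that E by (simp add: M.m_assoc)
    then show ?thesis
      using that E by (simp add: of_group_of_forest M.m_assoc of_group_mult act_closed)
  qed
  have "exp g E \<otimes>\<^bsub>L\<^esub> k = exp h E \<otimes>\<^bsub>L\<^esub> k"
    by (rule normal_form_unique(2)[of "act g E" _ "act h E"])
      (use assms E(1,2) x(2) in \<open>auto simp: act_closed simp flip: *\<close>)
  then have "exp g E = exp h E"
    using assms E act_closed by simp
  moreover obtain w where "pos_word w" "forest_of w = E"
    using E(1) by (rule forest_of_surj)
  ultimately show ?thesis
    using assms act_forest_of(2)[of _ w] word_exp_inject[of g h w] by auto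
qed


section \<open>Simple elements\<close>

abbreviation T :: "'a thompson_elt monoid" where "T \<equiv> big_thompson_group G \<iota> \<rho> \<kappa>"
abbreviation S :: "'a thompson_elt set" where "S \<equiv> simple_elements G \<iota> \<rho> \<kappa>"

definition thompson_forest :: "forest \<Rightarrow> 'a thompson_elt" where
  "thompson_forest E = thompson_in G \<iota> \<rho> \<kappa> (Inl E)"

definition thompson_group :: "(nat \<times> 'a) set \<Rightarrow> 'a thompson_elt" where
  "thompson_group g = thompson_in G \<iota> \<rho> \<kappa> (Inr g)"

lemma thompson_forest_eq: "thompson_forest E = frac_in M (of_forest E)"
  and thompson_group_eq: "thompson_group g = frac_in M (of_group g)"
  by (simp_all add: thompson_forest_def thompson_group_def thompson_in_def of_forest_def of_group_def
      word_class_def)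

lemma bracket_eq:
  "thompson_bracket G \<iota> \<rho> \<kappa> E g F
    = thompson_forest E \<otimes>\<^bsub>T\<^esub> thompson_group g \<otimes>\<^bsub>T\<^esub> inv\<^bsub>T\<^esub> thompson_forest F"
  by (simp add: thompson_bracket_def thompson_forest_def thompson_group_def)

sublocale T: group T
  unfolding big_thompson_group_def by (rule M.group_frac_group)

lemma frac_in_T: "frac_in M \<in> hom M T"
  unfolding big_thompson_group_def by (rule M.frac_in_hom)

lemma thompson_forest_closed [simp]: "E \<in> carrier forest_monoid \<Longrightarrow> thompson_forest E \<in> carrier T"
  using hom_in_carrier[OF frac_in_T] by (simp add: thompson_forest_eq)

lemma thompson_group_closed [simp]: "g \<in> carrier L \<Longrightarrow> thompson_group g \<in> carrier T"
  using hom_in_carrier[OF frac_in_T] by (simp add: thompson_group_eq)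

lemma thompson_forest_mult:
  "E \<in> carrier forest_monoid \<Longrightarrow> F \<in> carrier forest_monoid
    \<Longrightarrow> thompson_forest (forest_mult E F) = thompson_forest E \<otimes>\<^bsub>T\<^esub> thompson_forest F"
  using hom_mult[OF frac_in_T] by (simp add: thompson_forest_eq of_forest_mult)

lemma thompson_group_hom: "thompson_group \<in> hom L T"
proof (rule homI)
  fix g h assume "g \<in> carrier L" "h \<in> carrier L"
  then show "thompson_group (g \<otimes>\<^bsub>L\<^esub> h) = thompson_group g \<otimes>\<^bsub>T\<^esub> thompson_group h"
    using hom_mult[OF frac_in_T] by (simp add: thompson_group_eq of_group_mult)
qed simp

sublocale TG: group_hom L T thompson_group
  by unfold_locales (rule thompson_group_hom)

lemma thompson_group_forest_of:
  assumes "g \<in> carrier L" "pos_word w"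
  shows "thompson_group g \<otimes>\<^bsub>T\<^esub> thompson_forest (forest_of w)
    = thompson_forest (forest_of (word_act g w)) \<otimes>\<^bsub>T\<^esub> thompson_group (word_exp g w)"
  using of_group_of_word[OF assms] hom_mult[OF frac_in_T] assms
  by (metis forest_of_closed of_forest_closed of_group_closed thompson_forest_eq thompson_group_eq
      word_act_pos word_exp_closed)

end

section \<open>Products and inverses of simple elements\<close>

text \<open>The first equation turns \<open>inv e2 \<otimes> e3\<close> into
  \<open>f \<otimes> inv f'\<close>. The other two rewrite the outer parts
  \<open>g \<otimes> f\<close> and \<open>inv f' \<otimes> h\<close>, the latter being the inverse
  of \<open>inv h \<otimes> f'\<close>.\<close>

lemma (in group) bracket_mult:
  assumes C: "e1 \<in> carrier G" "g \<in> carrier G" "e2 \<in> carrier G" "e3 \<in> carrier G" "h \<in> carrier G"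
    "e4 \<in> carrier G" "f \<in> carrier G" "f' \<in> carrier G" "p \<in> carrier G" "a \<in> carrier G"
    "q \<in> carrier G" "b \<in> carrier G"
    and eq: "e2 \<otimes> f = e3 \<otimes> f'" "g \<otimes> f = p \<otimes> a" "inv h \<otimes> f' = q \<otimes> b"
  shows "(e1 \<otimes> g \<otimes> inv e2) \<otimes> (e3 \<otimes> h \<otimes> inv e4) = (e1 \<otimes> p) \<otimes> (a \<otimes> inv b) \<otimes> inv (e4 \<otimes> q)"
proof -
  have g: "g = p \<otimes> a \<otimes> inv f"
    using eq(2) C by (metis inv_solve_right m_closed)
  have "f' = h \<otimes> (q \<otimes> b)"
    using eq(3) C by (metis inv_solve_left inv_inv inv_closed m_closed)
  then have f': "inv f' = inv b \<otimes> inv q \<otimes> inv h"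
    using C by (simp add: inv_mult_group m_assoc)
  have e: "inv e2 \<otimes> e3 = f \<otimes> inv f'"
    using eq(1) C by (metis inv_solve_left inv_solve_right m_assoc m_closed inv_closed)
  have "(e1 \<otimes> g \<otimes> inv e2) \<otimes> (e3 \<otimes> h \<otimes> inv e4) = e1 \<otimes> g \<otimes> (inv e2 \<otimes> e3) \<otimes> h \<otimes> inv e4"
    using C by (simp add: m_assoc)
  also have "\<dots> = (e1 \<otimes> p) \<otimes> (a \<otimes> inv b) \<otimes> inv (e4 \<otimes> q)"
  proof -
    have "inv z \<otimes> (z \<otimes> x) = x" if "x \<in> carrier G" "z \<in> carrier G" for x z
      using that by (simp flip: m_assoc)
    then show ?thesis
      unfolding e f' unfolding g using C by (simp add: m_assoc inv_mult_group)
  qed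
  finally show ?thesis .
qed

context cloning_system
begin

lemma simple_elements_eq:
  "S = {thompson_forest E \<otimes>\<^bsub>T\<^esub> thompson_group g \<otimes>\<^bsub>T\<^esub> inv\<^bsub>T\<^esub> thompson_forest F | E g F n.
     1 \<le> n \<and> semisimple n E \<and> semisimple n F \<and> g \<in> stage n}"
  unfolding simple_elements_def bracket_eq stage_def by blast

lemma simpleI:
  "1 \<le> n \<Longrightarrow> semisimple n E \<Longrightarrow> semisimple n F \<Longrightarrow> g \<in> stage n
    \<Longrightarrow> thompson_forest E \<otimes>\<^bsub>T\<^esub> thompson_group g \<otimes>\<^bsub>T\<^esub> inv\<^bsub>T\<^esub> thompson_forest F \<in> S"
  unfolding simple_elements_eq by blast

lemma simpleE:
  assumes "x \<in> S"
  obtains n E g F where "1 \<le> n" "semisimple n E" "semisimple n F" "g \<in> stage n"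
    "x = thompson_forest E \<otimes>\<^bsub>T\<^esub> thompson_group g \<otimes>\<^bsub>T\<^esub> inv\<^bsub>T\<^esub> thompson_forest F"
  using assms unfolding simple_elements_eq by blast

lemma semisimple_closed: "semisimple n E \<Longrightarrow> E \<in> carrier forest_monoid"
  by (simp add: semisimple_def)

text \<open>Both forests are words valid from a single root, so
  \<open>forest_of_common_multiple\<close> applies with \<open>n = 1\<close>. The multipliers are
  kept as words because \<open>semisimple_mult\<close> counts feet along them.\<close>

lemma semisimple_common_multiple:
  assumes "semisimple m E" "semisimple n F"
  obtains u v where "valid m u" "valid n v" "m + length u = n + length v"
    "forest_mult E (forest_of u) = forest_mult F (forest_of v)"
proof -
  obtain x where x: "valid 1 x" "forest_of x = E" "m = 1 + length x"
    using assms(1) by (rule semisimpleE)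
  obtain y where y: "valid 1 y" "forest_of y = F" "n = 1 + length y"
    using assms(2) by (rule semisimpleE)
  obtain u v where uv: "valid (1 + length x) u" "valid (1 + length y) v"
    "length x + length u = length y + length v" "forest_of (x @ u) = forest_of (y @ v)"
    using forest_of_common_multiple[OF x(1) y(1)] by blast
  have "pos_word x" "pos_word y" "pos_word u" "pos_word v"
    using x(1) y(1) uv(1,2) valid_pos by blast+
  then have "forest_mult E (forest_of u) = forest_mult F (forest_of v)"
    using uv(4) x(2) y(2) by (simp add: forest_of_append)
  then show ?thesis
    using that[of u v] x(3) y(3) uv by simp
qed

lemma simple_mult:
  assumes "x \<in> S" "y \<in> S"
  shows "x \<otimes>\<^bsub>T\<^esub> y \<in> S"
proof -
  obtain m E1 g E2 where 1: "1 \<le> m" "semisimple m E1" "semisimple m E2" "g \<in> stage m"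
    "x = thompson_forest E1 \<otimes>\<^bsub>T\<^esub> thompson_group g \<otimes>\<^bsub>T\<^esub> inv\<^bsub>T\<^esub> thompson_forest E2"
    using assms(1) by (rule simpleE)
  obtain n E3 h E4 where 2: "1 \<le> n" "semisimple n E3" "semisimple n E4" "h \<in> stage n"
    "y = thompson_forest E3 \<otimes>\<^bsub>T\<^esub> thompson_group h \<otimes>\<^bsub>T\<^esub> inv\<^bsub>T\<^esub> thompson_forest E4"
    using assms(2) by (rule simpleE)
  obtain u v where uv: "valid m u" "valid n v" "m + length u = n + length v"
    "forest_mult E2 (forest_of u) = forest_mult E3 (forest_of v)"
    using 1(3) 2(2) by (rule semisimple_common_multiple)
  \<comment> \<open>The forest of \<open>v\<close> enters the product inverted and to the left of
    \<open>h\<close>, which is why the inverse of \<open>h\<close> is pushed through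
    \<open>v\<close>.\<close>
  define p q where "p = word_act g u" and "q = word_act (inv\<^bsub>L\<^esub> h) v"
  define a b where "a = word_exp g u" and "b = word_exp (inv\<^bsub>L\<^esub> h) v"
  have h': "inv\<^bsub>L\<^esub> h \<in> stage n"
    using 2 stage_inv by simp
  have L: "g \<in> carrier L" "h \<in> carrier L" "inv\<^bsub>L\<^esub> h \<in> carrier L"
    using 1 2 h' stage_subset by blast+
  \<comment> \<open>Pushing through a word preserves its length and validity. As
    \<open>m + length u = n + length v\<close>, the elements \<open>a\<close> and \<open>b\<close>
    land in a common stage, which is also the number of feet of both new forests.\<close>
  have p: "valid m p" "length p = length u" "a \<in> stage (m + length u)"
    using word_act_valid[OF 1(1,4) uv(1)] by (simp_all add: p_def a_def length_word_act)
  have q: "valid n q" "length q = length v" "b \<in> stage (m + length u)"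
    using word_act_valid[OF 2(1) h' uv(2)] uv(3) by (simp_all add: q_def b_def length_word_act)
  have pos: "pos_word u" "pos_word v" "pos_word p" "pos_word q"
    using uv p q valid_pos by blast+
  have ab: "a \<in> carrier L" "b \<in> carrier L"
    using pos L by (auto simp: a_def b_def word_exp_closed)
  have F: "forest_of u \<in> carrier forest_monoid" "forest_of v \<in> carrier forest_monoid"
    "forest_of p \<in> carrier forest_monoid" "forest_of q \<in> carrier forest_monoid"
    using pos forest_of_closed by auto
  have E: "E1 \<in> carrier forest_monoid" "E2 \<in> carrier forest_monoid" "E3 \<in> carrier forest_monoid"
    "E4 \<in> carrier forest_monoid"
    using 1 2 semisimple_closed by auto
  have "x \<otimes>\<^bsub>T\<^esub> y = (thompson_forest E1 \<otimes>\<^bsub>T\<^esub> thompson_forest (forest_of p))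
      \<otimes>\<^bsub>T\<^esub> (thompson_group a \<otimes>\<^bsub>T\<^esub> inv\<^bsub>T\<^esub> thompson_group b)
      \<otimes>\<^bsub>T\<^esub> inv\<^bsub>T\<^esub> (thompson_forest E4 \<otimes>\<^bsub>T\<^esub> thompson_forest (forest_of q))"
    unfolding 1(5) 2(5)
  proof (rule T.bracket_mult)
    show "thompson_forest E2 \<otimes>\<^bsub>T\<^esub> thompson_forest (forest_of u)
        = thompson_forest E3 \<otimes>\<^bsub>T\<^esub> thompson_forest (forest_of v)"
      using uv(4) E F by (simp flip: thompson_forest_mult)
    show "thompson_group g \<otimes>\<^bsub>T\<^esub> thompson_forest (forest_of u)
        = thompson_forest (forest_of p) \<otimes>\<^bsub>T\<^esub> thompson_group a"
      unfolding p_def a_def using L pos by (intro thompson_group_forest_of)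
    have "inv\<^bsub>T\<^esub> thompson_group h = thompson_group (inv\<^bsub>L\<^esub> h)"
      using L by simp
    then show "inv\<^bsub>T\<^esub> thompson_group h \<otimes>\<^bsub>T\<^esub> thompson_forest (forest_of v)
        = thompson_forest (forest_of q) \<otimes>\<^bsub>T\<^esub> thompson_group b"
      unfolding q_def b_def using thompson_group_forest_of[OF L(3) pos(2)] by (simp only:)
  qed (use E F L ab in simp_all)
  also have "\<dots> = thompson_forest (forest_mult E1 (forest_of p))
      \<otimes>\<^bsub>T\<^esub> thompson_group (a \<otimes>\<^bsub>L\<^esub> inv\<^bsub>L\<^esub> b) \<otimes>\<^bsub>T\<^esub> inv\<^bsub>T\<^esub> thompson_forest (forest_mult E4 (forest_of q))"
    using E F ab by (simp add: thompson_forest_mult)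
  also have "\<dots> \<in> S"
  proof (rule simpleI)
    show "1 \<le> m + length u" using 1 by simp
    show "semisimple (m + length u) (forest_mult E1 (forest_of p))"
      using semisimple_mult[OF 1(2) p(1)] p(2) by simp
    show "semisimple (m + length u) (forest_mult E4 (forest_of q))"
      using semisimple_mult[OF 2(3) q(1)] q(2) uv(3) by simp
    show "a \<otimes>\<^bsub>L\<^esub> inv\<^bsub>L\<^esub> b \<in> stage (m + length u)"
      using p q 1(1) by (intro stage_mult stage_inv) auto
  qed
  finally show ?thesis .
qed

lemma simple_closed:
  assumes "x \<in> S"
  shows "x \<in> carrier T"
proof -
  obtain n E g F where *: "1 \<le> n" "semisimple n E" "semisimple n F" "g \<in> stage n"
    "x = thompson_forest E \<otimes>\<^bsub>T\<^esub> thompson_group g \<otimes>\<^bsub>T\<^esub> inv\<^bsub>T\<^esub> thompson_forest F"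
    using assms by (rule simpleE)
  moreover have "g \<in> carrier L"
    using * stage_subset by blast
  ultimately show ?thesis
    by (simp add: semisimple_closed)
qed

lemma simple_inv:
  assumes "x \<in> S"
  shows "inv\<^bsub>T\<^esub> x \<in> S"
proof -
  obtain n E g F where *: "1 \<le> n" "semisimple n E" "semisimple n F" "g \<in> stage n"
    "x = thompson_forest E \<otimes>\<^bsub>T\<^esub> thompson_group g \<otimes>\<^bsub>T\<^esub> inv\<^bsub>T\<^esub> thompson_forest F"
    using assms by (rule simpleE)
  have g: "g \<in> carrier L" and "E \<in> carrier forest_monoid" "F \<in> carrier forest_monoid"
    using * stage_subset semisimple_closed by blast+
  then have "inv\<^bsub>T\<^esub> x = thompson_forest F \<otimes>\<^bsub>T\<^esub> thompson_group (inv\<^bsub>L\<^esub> g) \<otimes>\<^bsub>T\<^esub> inv\<^bsub>T\<^esub> thompson_forest E"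
    by (simp add: *(5) T.inv_mult_group T.m_assoc)
  then show ?thesis
    using * stage_inv by (simp add: simpleI)
qed

lemma stage_one: "1 \<le> n \<Longrightarrow> \<one>\<^bsub>L\<^esub> \<in> stage n"
  using group.is_monoid[OF group_G] by (auto simp: stage_def lim_one[of n] monoid.one_closed)

section \<open>The subgroup of simple elements and the embedded stages\<close>

lemma subgroup_simple: "subgroup S T"
proof (rule T.subgroupI)
  show "S \<subseteq> carrier T"
    using simple_closed by blast
  have "semisimple 1 empty_forest" "\<one>\<^bsub>L\<^esub> \<in> stage 1"
    using semisimple_empty stage_one by auto
  then show "S \<noteq> {}"
    using simpleI[of 1] by blast
qed (use simple_inv simple_mult in auto)

lemma stage_embedding:
  assumes n: "1 \<le> n"
  shows "\<exists>H. subgroup H (generalized_thompson_group G \<iota> \<rho> \<kappa>)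
    \<and> G n \<cong> (generalized_thompson_group G \<iota> \<rho> \<kappa>)\<lparr>carrier := H\<rparr>"
proof -
  obtain E where E: "semisimple n E"
    using n by (rule semisimple_exists)
  let ?e = "thompson_forest E"
  have e: "?e \<in> carrier T"
    using semisimple_closed[OF E] by simp
  define \<phi> where "\<phi> g = ?e \<otimes>\<^bsub>T\<^esub> thompson_group (lim_in G \<iota> n g) \<otimes>\<^bsub>T\<^esub> inv\<^bsub>T\<^esub> ?e" for g
  have hom: "\<phi> \<in> hom (G n) T"
  proof (rule homI)
    fix g h assume "g \<in> carrier (G n)" "h \<in> carrier (G n)"
    then have "lim_in G \<iota> n g \<in> carrier L" "lim_in G \<iota> n h \<in> carrier L"
      "lim_in G \<iota> n (g \<otimes>\<^bsub>G n\<^esub> h) = lim_in G \<iota> n g \<otimes>\<^bsub>L\<^esub> lim_in G \<iota> n h"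
      using n by (simp_all add: lim_in_closed lim_mult)
    then show "\<phi> (g \<otimes>\<^bsub>G n\<^esub> h) = \<phi> g \<otimes>\<^bsub>T\<^esub> \<phi> h"
      using e by (simp add: \<phi>_def T.m_assoc T.inv_solve_left)
  qed (use e n in \<open>simp add: \<phi>_def lim_in_closed\<close>)
  have inj: "inj_on \<phi> (carrier (G n))"
  proof (rule inj_onI)
    fix g h assume gh: "g \<in> carrier (G n)" "h \<in> carrier (G n)" and eq: "\<phi> g = \<phi> h"
    have "lim_in G \<iota> n g \<in> carrier L" "lim_in G \<iota> n h \<in> carrier L"
      using gh n by (simp_all add: lim_in_closed)
    \<comment> \<open>Conjugation by \<open>?e\<close> cancels in \<open>T\<close>. It remains to
      combine injectivity on the limit with that of \<open>lim_in G \<iota> n\<close>.\<close>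
    moreover from this have "thompson_group (lim_in G \<iota> n g) = thompson_group (lim_in G \<iota> n h)"
      using eq e by (simp add: \<phi>_def)
    ultimately show "g = h"
      using gh n of_group_frac_inject lim_in_inject by (simp add: thompson_group_eq)
  qed
  let ?H = "\<phi> ` carrier (G n)"
  interpret \<phi>: group_hom "G n" T \<phi>
    using group_G[OF n] T.is_group hom by (intro group_hom.intro group_hom_axioms.intro)
  \<comment> \<open>The same forest \<open>E\<close> with \<open>n\<close> feet stands on both
    sides, matching the stage of the group element.\<close>
  have "?H \<subseteq> S"
    using simpleI[OF n E E] by (auto simp: \<phi>_def stage_def)
  then have "subgroup ?H (generalized_thompson_group G \<iota> \<rho> \<kappa>)"
    unfolding generalized_thompson_group_def
    by (rule T.subgroup_incl[OF \<phi>.img_is_subgroup subgroup_simple])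
  moreover have "\<phi> \<in> iso (G n) ((generalized_thompson_group G \<iota> \<rho> \<kappa>)\<lparr>carrier := ?H\<rparr>)"
    using hom inj by (auto simp: iso_def hom_def bij_betw_def generalized_thompson_group_def)
  ultimately show ?thesis
    by (auto simp: is_iso_def)
qed

end

theorem proposition2p24:
  fixes G :: "nat \<Rightarrow> 'a monoid"
    and \<iota> :: "nat \<Rightarrow> nat \<Rightarrow> 'a \<Rightarrow> 'a"
    and \<rho> :: "nat \<Rightarrow> 'a \<Rightarrow> nat \<Rightarrow> nat"
    and \<kappa> :: "nat \<Rightarrow> nat \<Rightarrow> 'a \<Rightarrow> 'a"
  assumes "cloning_system G \<iota> \<rho> \<kappa>"
  shows "group (big_thompson_group G \<iota> \<rho> \<kappa>)
    \<and> subgroup (simple_elements G \<iota> \<rho> \<kappa>) (big_thompson_group G \<iota> \<rho> \<kappa>)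
    \<and> (\<forall>n\<ge>1. \<exists>H. subgroup H (generalized_thompson_group G \<iota> \<rho> \<kappa>)
            \<and> G n \<cong> (generalized_thompson_group G \<iota> \<rho> \<kappa>)\<lparr>carrier := H\<rparr>)"
proof -
  interpret cloning_system G \<iota> \<rho> \<kappa> by fact
  show ?thesis
    using T.is_group subgroup_simple stage_embedding by blast
qed

end
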